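(* Let $p>2$ be a prime, let $k$ be an algebraically closed field of characteristic $p$, let $n\ge 1$, and let $n_1,\dots,n_n\ge 0$ be integers. Let $A_n=k\langle x_1,\dots,x_n\rangle$ be the free associative unital $k$-algebra on $n$ generators, let $f_1,\dots,f_m\in A_n$ be noncommutative polynomials in $x_1^{p^{n_1}},\dots,x_n^{p^{n_n}}$ (i.e. elements of the unital $k$-subalgebra of $A_n$ generated by these powers), and let $A=A_n/(f_1,\dots,f_m)$ be the quotient by the two-sided ideal they generate. Let $1\le r\le n$ and suppose that each $f_l$ is homogeneous in each of the variables $x_1,\dots,x_r$, so that $A$ and every $N_i(A)$ are graded by the degrees in $x_1,\dots,x_r$. Let $i\ge1$ and assume that the components of $N_i(A)$ for this $\mathbb{Z}_{\ge0}^r$-grading are finite dimensional, so that the Hilbert series $$h(X_1,\dots,X_r)=\sum_{(d_1,\dots,d_r)\in\mathbb{Z}_{\ge0}^r}\dim_k\big(N_i(A)_{(d_1,\dots,d_r)}\big)X_1^{d_1}\cdots X_r^{d_r}$$ is defined. Then $h$ is divisible by $$(1+X_1+\cdots+X_1^{p^{n_1}-1})\cdots(1+X_r+\cdots+X_r^{p^{n_r}-1}),$$ in the sense that the ratio is a power series with non-negative integer coefficients.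
   Context: For an associative algebra $A$, define $L_1(A)=A$ and $L_{i+1}(A)=[A,L_i(A)]$ (the linear span of all commutators $[a,l]=al-la$ with $a\in A$, $l\in L_i(A)$), $M_i(A)=A\,L_i(A)\,A$ (the two-sided ideal generated by $L_i(A)$), and $N_i(A)=M_i(A)/M_{i+1}(A)$. $N_i(A)_{(d_1,\dots,d_r)}$ is the component of degree $d_s$ in $x_s$ for $s=1,\dots,r$. *)

theory Defs
  imports
    "HOL-Library.Poly_Mapping"
    "HOL-Algebra.QuotRing"
    "HOL-Algebra.Subrings"
    "Jordan_Normal_Form.VS_Connect"
begin

hide_const (open) Multiset.mult Polynomial.smult Modules.module

text \<open>
  Noncommutative monomials form the free monoid on the letters. It is written additively because
  the product on \<^typ>\<open>'m \<Rightarrow>\<^sub>0 'k\<close> is the monoid-algebra (convolution) product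
  for an additive monoid \<^typ>\<open>'m\<close> of exponents.
\<close>

datatype 'a ncmonom = NCMonom (letters: "'a list")

instantiation ncmonom :: (type) monoid_add
begin

definition zero_ncmonom :: "'a ncmonom" where "0 = NCMonom []"

definition plus_ncmonom :: "'a ncmonom \<Rightarrow> 'a ncmonom \<Rightarrow> 'a ncmonom"
  where "u + v = NCMonom (letters u @ letters v)"

instance
  by standard (simp_all add: zero_ncmonom_def plus_ncmonom_def)

end

type_synonym 'k ncpoly = "nat ncmonom \<Rightarrow>\<^sub>0 'k"

definition ncvar :: "nat \<Rightarrow> 'k::field ncpoly"
  where "ncvar s = Poly_Mapping.single (NCMonom [s]) 1"

definition scale_ncpoly :: "'k::field \<Rightarrow> 'k ncpoly \<Rightarrow> 'k ncpoly"
  where "scale_ncpoly c a = Poly_Mapping.map (\<lambda>t. c * t) a"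

definition free_algebra :: "nat \<Rightarrow> ('k::field, 'k ncpoly) module"
  where "free_algebra n =
    \<lparr>carrier = {a. \<forall>w \<in> Poly_Mapping.keys a. set (letters w) \<subseteq> {1..n}},
     mult = (*), one = 1, zero = 0, add = (+), smult = scale_ncpoly\<rparr>"

lemma lookup_scale_ncpoly [simp]:
  "Poly_Mapping.lookup (scale_ncpoly c a) w = c * Poly_Mapping.lookup a w"
  by (simp add: scale_ncpoly_def Poly_Mapping.map.rep_eq when_def)

lemma scale_ncpoly_conv_mult: "scale_ncpoly c a = Poly_Mapping.single 0 c * a"
  unfolding scale_ncpoly_def by (rule mult_map_scale_conv_mult)

lemma keys_mult_ncpoly:
  assumes "w \<in> Poly_Mapping.keys (a * b)"
  obtains u v where "u \<in> Poly_Mapping.keys a" "v \<in> Poly_Mapping.keys b"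
    "letters w = letters u @ letters v"
  using subsetD[OF keys_mult assms] by (auto simp: plus_ncmonom_def)

lemma free_algebra_ring: "ring (free_algebra n :: ('k::field, 'k ncpoly) module)"
proof (rule ringI)
  show "abelian_group (free_algebra n :: ('k, 'k ncpoly) module)"
  proof (rule abelian_groupI)
    fix x y :: "'k ncpoly"
    assume "x \<in> carrier (free_algebra n)" "y \<in> carrier (free_algebra n)"
    then show "x \<oplus>\<^bsub>free_algebra n\<^esub> y \<in> carrier (free_algebra n)"
      using keys_add[of x y] by (fastforce simp: free_algebra_def)
  next
    fix x :: "'k ncpoly"
    assume "x \<in> carrier (free_algebra n)"
    then show "\<exists>y\<in>carrier (free_algebra n). y \<oplus>\<^bsub>free_algebra n\<^esub> x = \<zero>\<^bsub>free_algebra n\<^esub>"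
      by (intro bexI[of _ "- x"]) (auto simp: free_algebra_def)
  qed (auto simp: free_algebra_def ac_simps)
  show "monoid (free_algebra n :: ('k, 'k ncpoly) module)"
  proof (rule monoidI)
    fix x y :: "'k ncpoly"
    assume "x \<in> carrier (free_algebra n)" "y \<in> carrier (free_algebra n)"
    then have "set (letters w) \<subseteq> {1..n}" if "w \<in> Poly_Mapping.keys (x * y)" for w
      using that unfolding free_algebra_def by (elim keys_mult_ncpoly) auto
    then show "x \<otimes>\<^bsub>free_algebra n\<^esub> y \<in> carrier (free_algebra n)"
      by (simp add: free_algebra_def)
  qed (auto simp: free_algebra_def ac_simps zero_ncmonom_def)
qed (auto simp: free_algebra_def algebra_simps)

lemma free_algebra_module:
  "Module.module class_ring (free_algebra n :: ('k::field, 'k ncpoly) module)"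
proof (rule moduleI)
  show "abelian_group (free_algebra n :: ('k, 'k ncpoly) module)"
    using free_algebra_ring by (rule ring.axioms)
  show "cring (class_ring :: 'k ring)"
    by (rule class_cring.cring_axioms)
qed (auto simp: free_algebra_def in_keys_iff lookup_add algebra_simps intro!: poly_mapping_eqI)

definition degree_in :: "nat \<Rightarrow> nat ncmonom \<Rightarrow> nat"
  where "degree_in s w = count_list (letters w) s"

definition homogeneous_in :: "nat \<Rightarrow> 'k::field ncpoly \<Rightarrow> bool"
  where "homogeneous_in s a \<longleftrightarrow> (\<exists>e. \<forall>w \<in> Poly_Mapping.keys a. degree_in s w = e)"

definition free_component :: "nat \<Rightarrow> nat \<Rightarrow> (nat \<Rightarrow>\<^sub>0 nat) \<Rightarrow> 'k::field ncpoly set"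
  where "free_component n r d =
    {a \<in> carrier (free_algebra n).
       \<forall>w \<in> Poly_Mapping.keys a. \<forall>s \<in> {1..r}. degree_in s w = Poly_Mapping.lookup d s}"

text \<open>
  The locale \<^locale>\<open>algebra\<close> of the library is restricted to commutative algebras. An
  associative algebra over the field \<^typ>\<open>'k\<close> is given here by a \<^typ>\<open>('k, 'a) module\<close>
  record, whose ring structure need not be commutative.
\<close>

definition generated_subalgebra :: "('k::field, 'a) module \<Rightarrow> 'a set \<Rightarrow> 'a set"
  where "generated_subalgebra A S =
    \<Inter>{B. subring B A \<and> (\<forall>c. \<forall>b \<in> B. c \<odot>\<^bsub>A\<^esub> b \<in> B) \<and> S \<subseteq> B}"

text \<open>
  The coset space of \<^term>\<open>A Quot I\<close> with its induced scalar multiplication. When \<^term>\<open>I\<close>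
  is a two-sided ideal this is the quotient algebra; when \<^term>\<open>I\<close> is only a subspace, the
  additive and scalar structure is the quotient vector space and the multiplication is irrelevant.
\<close>

definition quotient_algebra :: "('k::field, 'a) module \<Rightarrow> 'a set \<Rightarrow> ('k, 'a set) module"
  where "quotient_algebra A I =
    ring.extend (A Quot I) (module.fields (\<lambda>c X. \<Union>x\<in>X. I +>\<^bsub>A\<^esub> (c \<odot>\<^bsub>A\<^esub> x)))"

lemma quotient_algebra_simps:
  "carrier (quotient_algebra A I) = carrier (A Quot I)"
  "mult (quotient_algebra A I) = mult (A Quot I)"
  "one (quotient_algebra A I) = one (A Quot I)"
  "zero (quotient_algebra A I) = zero (A Quot I)"
  "add (quotient_algebra A I) = add (A Quot I)"
  "smult (quotient_algebra A I) c X = (\<Union>x\<in>X. I +>\<^bsub>A\<^esub> (c \<odot>\<^bsub>A\<^esub> x))"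
  by (simp_all add: quotient_algebra_def ring.defs module.defs)

text \<open>The series starts at index 1; the value at index 0 is a dummy.\<close>

fun lower_central :: "('k::field, 'a) module \<Rightarrow> nat \<Rightarrow> 'a set"
  where
    "lower_central A 0 = carrier A"
  | "lower_central A (Suc 0) = carrier A"
  | "lower_central A (Suc (Suc i)) =
      LinearCombinations.module.span class_ring A
        {(a \<otimes>\<^bsub>A\<^esub> l) \<ominus>\<^bsub>A\<^esub> (l \<otimes>\<^bsub>A\<^esub> a) | a l.
          a \<in> carrier A \<and> l \<in> lower_central A (Suc i)}"

definition lower_central_ideal :: "('k::field, 'a) module \<Rightarrow> nat \<Rightarrow> 'a set"
  where "lower_central_ideal A i = Idl\<^bsub>A\<^esub> (lower_central A i)"

definition lower_central_quotient :: "('k::field, 'a) module \<Rightarrow> nat \<Rightarrow> ('k, 'a set) module"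
  where "lower_central_quotient A i =
    quotient_algebra (A\<lparr>carrier := lower_central_ideal A i\<rparr>) (lower_central_ideal A (Suc i))"

text \<open>
  The graded piece of \<open>N\<^sub>i(A)\<close> determined by a graded piece \<open>V\<close> of \<open>A\<close>: the image of
  \<open>M\<^sub>i(A) \<inter> V\<close>.
\<close>

definition lower_central_component ::
    "('k::field, 'a) module \<Rightarrow> nat \<Rightarrow> 'a set \<Rightarrow> ('k, 'a set) module"
  where "lower_central_component A i V =
    (lower_central_quotient A i)
      \<lparr>carrier := (\<lambda>x. lower_central_ideal A (Suc i) +>\<^bsub>A\<^esub> x) ` (lower_central_ideal A i \<inter> V)\<rparr>"

text \<open>
  Formal power series in commuting variables indexed by \<^typ>\<open>nat\<close>, given by their coefficients at
  the finitely supported exponent vectors.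
\<close>

typedef 'a mpowser = "UNIV :: ((nat \<Rightarrow>\<^sub>0 nat) \<Rightarrow> 'a) set"
  morphisms mcoeff Abs_mpowser ..

setup_lifting type_definition_mpowser

lemma mpowser_eqI: "(\<And>d. mcoeff f d = mcoeff g d) \<Longrightarrow> f = g"
  by transfer auto

lemma finite_exponent_splits: "finite {(a, b). a + b = (d :: nat \<Rightarrow>\<^sub>0 nat)}"
proof -
  let ?F = "{f. \<forall>x. (x \<in> Poly_Mapping.keys d \<longrightarrow>
                     f x \<in> {0..Max (range (Poly_Mapping.lookup d))}) \<and>
                   (x \<notin> Poly_Mapping.keys d \<longrightarrow> f x = (0::nat))}"
  have fin_range: "finite (range (Poly_Mapping.lookup d))"
  proof -
    have "range (Poly_Mapping.lookup d) \<subseteq> insert 0 (Poly_Mapping.lookup d ` Poly_Mapping.keys d)"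
      by (auto simp: in_keys_iff)
    then show ?thesis by (rule finite_subset) simp
  qed
  have fin: "finite ?F"
    by (rule finite_set_of_finite_funs) simp_all
  have sub: "Poly_Mapping.lookup ` {a. \<exists>b. a + b = d} \<subseteq> ?F"
  proof
    fix f assume "f \<in> Poly_Mapping.lookup ` {a. \<exists>b. a + b = d}"
    then obtain a b where f: "f = Poly_Mapping.lookup a" and ab: "a + b = d" by auto
    have le: "f x \<le> Poly_Mapping.lookup d x" for x
      unfolding f ab[symmetric] by (simp add: lookup_add)
    have "f x \<le> Max (range (Poly_Mapping.lookup d))" for x
      using le[of x] Max_ge[OF fin_range, of "Poly_Mapping.lookup d x"] by simp
    moreover have "f x = 0" if "x \<notin> Poly_Mapping.keys d" for x
      using le[of x] that by (simp add: in_keys_iff)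
    ultimately show "f \<in> ?F" by auto
  qed
  have "finite {a. \<exists>b. a + b = d}"
    by (rule finite_imageD[OF finite_subset[OF sub fin]])
      (auto intro!: inj_onI poly_mapping_eqI)
  moreover have "{(a, b). a + b = d} \<subseteq> (\<lambda>a. (a, d - a)) ` {a. \<exists>b. a + b = d}"
    by auto
  ultimately show ?thesis by (meson finite_imageI finite_subset)
qed

instantiation mpowser :: (comm_semiring_1) comm_semiring_1
begin

lift_definition zero_mpowser :: "'a mpowser" is "\<lambda>_. 0" .

lift_definition one_mpowser :: "'a mpowser" is "\<lambda>d. if d = 0 then 1 else 0" .

lift_definition plus_mpowser :: "'a mpowser \<Rightarrow> 'a mpowser \<Rightarrow> 'a mpowser" is "\<lambda>f g d. f d + g d" .

lift_definition times_mpowser :: "'a mpowser \<Rightarrow> 'a mpowser \<Rightarrow> 'a mpowser"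
  is "\<lambda>f g d. \<Sum>(a, b) \<in> {(a, b). a + b = d}. f a * g b" .

instance
proof
  fix f g h :: "'a mpowser"
  show "f + g + h = f + (g + h)" "f + g = g + f" "0 + f = f"
    by (transfer, simp add: ac_simps)+
  show "0 * f = 0" "f * 0 = 0"
    by (transfer, simp)+
  show "(f + g) * h = f * h + g * h"
    by transfer (simp add: algebra_simps sum.distrib split_def)
  show "f * g = g * f"
    by transfer
      (rule ext, rule sum.reindex_bij_witness[of _ prod.swap prod.swap], auto simp: ac_simps)
  show "(0 :: 'a mpowser) \<noteq> 1"
    by transfer (metis zero_neq_one)
  show "1 * f = f"
  proof (transfer, rule ext)
    fix f :: "(nat \<Rightarrow>\<^sub>0 nat) \<Rightarrow> 'a" and d
    have "(\<Sum>(a, b) \<in> {(a, b). a + b = d}. (if a = 0 then 1 else 0) * f b)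
        = (\<Sum>(a, b) \<in> {(0 :: nat \<Rightarrow>\<^sub>0 nat, d)}. (if a = 0 then 1 else 0) * f b)"
      by (rule sum.mono_neutral_right) (auto simp: finite_exponent_splits split: if_splits)
    then show "(\<Sum>(a, b) \<in> {(a, b). a + b = d}. (if a = 0 then 1 else 0) * f b) = f d"
      by simp
  qed
  show "f * g * h = f * (g * h)"
  proof (transfer, rule ext)
    fix f g h :: "(nat \<Rightarrow>\<^sub>0 nat) \<Rightarrow> 'a" and d
    let ?D = "\<lambda>d. {(a, b). a + b = (d :: nat \<Rightarrow>\<^sub>0 nat)}"
    have "(\<Sum>(u, c) \<in> ?D d. (\<Sum>(a, b) \<in> ?D u. f a * g b) * h c)
        = (\<Sum>(y, z) \<in> Sigma (?D d) (\<lambda>y. ?D (fst y)). f (fst z) * g (snd z) * h (snd y))"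
      by (subst sum.Sigma[symmetric])
        (auto simp: finite_exponent_splits
          finite_exponent_splits[unfolded split_def] sum_distrib_right split_def)
    also have "\<dots> = (\<Sum>(y, z) \<in> Sigma (?D d) (\<lambda>y. ?D (snd y)). f (fst y) * (g (fst z) * h (snd z)))"
      by (rule sum.reindex_bij_witness
          [of _ "\<lambda>((a, v), (b, c)). ((a + b, c), (a, b))" "\<lambda>((u, c), (a, b)). ((a, b + c), (b, c))"])
        (auto simp: ac_simps)
    also have "\<dots> = (\<Sum>(a, v) \<in> ?D d. f a * (\<Sum>(b, c) \<in> ?D v. g b * h c))"
      by (subst sum.Sigma[symmetric])
        (auto simp: finite_exponent_splits
          finite_exponent_splits[unfolded split_def] sum_distrib_left split_def)
    finally show "(\<Sum>(u, c) \<in> ?D d. (\<Sum>(a, b) \<in> ?D u. f a * g b) * h c)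
        = (\<Sum>(a, v) \<in> ?D d. f a * (\<Sum>(b, c) \<in> ?D v. g b * h c))" .
  qed
qed

end

lift_definition mX :: "nat \<Rightarrow> 'a::comm_semiring_1 mpowser"
  is "\<lambda>s d. if d = Poly_Mapping.single s 1 then 1 else 0" .

definition mpowser_in_vars :: "nat set \<Rightarrow> 'a::zero mpowser \<Rightarrow> bool"
  where "mpowser_in_vars S f \<longleftrightarrow> (\<forall>d. \<not> Poly_Mapping.keys d \<subseteq> S \<longrightarrow> mcoeff f d = 0)"

text \<open>
  The generating series in \<open>X\<^sub>1, \<dots>, X\<^sub>r\<close> of the dimensions of a family of vector spaces indexed by
  the multidegrees supported in \<open>{1..r}\<close>; meaningful if those spaces are finite dimensional.
\<close>

lift_definition hilbert_series :: "nat \<Rightarrow> ((nat \<Rightarrow>\<^sub>0 nat) \<Rightarrow> ('k::field, 'a) module) \<Rightarrow> int mpowser"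
  is "\<lambda>r V d. if Poly_Mapping.keys d \<subseteq> {1..r}
               then int (vectorspace.dim class_ring (V d)) else 0" .

end

(* Replacing x_s by x_s + t with t central gives the Hasse derivatives D^(j) of the free algebra in the
   variable x_s. For q = p^(n_s) and 0 < j < q they kill x_s^q, hence all f_l, so they preserve
   (f_1, ..., f_m); by the Leibniz rule they also preserve the lower central ideals and act on N_i(A).
   Together with left multiplication by x = x_s they satisfy the relations of truncated divided power
   differential operators, and P = SUM_{j<q} (-x)^j D^(j) projects onto the common kernel V_0 of the
   D^(j) with 0 < j < q. From v = SUM_{j<q} x^j P(D^(j) v) one gets N_i(A) = V_0 + x V_0 + ... + x^(q-1) V_0,
   a direct sum. The operators for x_s commute with left multiplication by x_t and with the operators for
   x_t, so the variables are split off one at a time, and the quotient series counts the joint kernel. *)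

theory Submission
  imports Defs "HOL-Computational_Algebra.Formal_Power_Series"
begin

section \<open>Hasse derivatives\<close>

text \<open>Iterated derivatives cannot play the part of the D^(j): in characteristic p the operator
  d^j/dx^j loses all information from j = p on, whereas its formal quotient by j!, the coefficient
  of t^j, makes sense over every field. That q is a power of p enters through two families of
  binomial coefficients. C(q, l) with 0 < l < q vanishes, so D^(j) kills x^q; and C(a + b, a) with
  a, b < q <= a + b vanishes, so D^(a) D^(b) = 0 there. The second fact is essential because D^(q)
  x^q = 1: operators of order q and above need not preserve (f_1, ..., f_m), so all sums have to
  close up among the orders below q. The operators are never defined on cosets. All computations use
  representatives in the free algebra: N_i(A) is replaced by the preimages of M_i(A) and M_{i+1}(A),
  equality in N_i(A) by congruence modulo the second preimage, and dimension by the size of a finite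
  set that is a basis modulo that subspace.\<close>

definition taylor_letter :: "nat \<Rightarrow> nat \<Rightarrow> 'k::field ncpoly fps"
  where "taylor_letter s u = fps_const (ncvar u) + (if u = s then fps_X else 0)"

text \<open>The substitution x_s -> x_s + t. The variable of a power series commutes with all
  coefficients, even when these do not commute with each other, so it serves as the central
  t.\<close>

definition taylor :: "nat \<Rightarrow> 'k::field ncpoly \<Rightarrow> 'k ncpoly fps"
  where "taylor s a = (\<Sum>w \<in> Poly_Mapping.keys a.
    fps_const (Poly_Mapping.single 0 (Poly_Mapping.lookup a w)) * prod_list (map (taylor_letter s) (letters w)))"

definition hasse :: "nat \<Rightarrow> nat \<Rightarrow> 'k::field ncpoly \<Rightarrow> 'k ncpoly"
  where "hasse s j a = fps_nth (taylor s a) j"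

lemma sum_single_lookup:
  "(\<Sum>w\<in>Poly_Mapping.keys a. Poly_Mapping.single w (Poly_Mapping.lookup a w)) = a"
  by (rule poly_mapping_eqI)
    (simp add: lookup_sum lookup_single when_def in_keys_iff)

lemma single_0_commute: "Poly_Mapping.single 0 c * a = a * Poly_Mapping.single 0 c"
  for a :: "'k::field ncpoly"
proof -
  have "Poly_Mapping.single 0 c * (\<Sum>w\<in>Poly_Mapping.keys a. Poly_Mapping.single w (Poly_Mapping.lookup a w))
    = (\<Sum>w\<in>Poly_Mapping.keys a. Poly_Mapping.single w (Poly_Mapping.lookup a w)) * Poly_Mapping.single 0 c"
    by (simp add: sum_distrib_left sum_distrib_right mult_single ac_simps)
  then show ?thesis
    by (simp add: sum_single_lookup)
qed

lemma fps_const_single_0_commute: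
  "fps_const (Poly_Mapping.single 0 c) * f = f * fps_const (Poly_Mapping.single 0 c)"
  for f :: "'k::field ncpoly fps"
  by (rule fps_ext) (simp add: single_0_commute)

lemma taylor_superset:
  assumes "finite K" "Poly_Mapping.keys a \<subseteq> K"
  shows "taylor s a = (\<Sum>w \<in> K. fps_const (Poly_Mapping.single 0 (Poly_Mapping.lookup a w)) *
    prod_list (map (taylor_letter s) (letters w)))"
  unfolding taylor_def using assms by (intro sum.mono_neutral_left) (auto simp: in_keys_iff)

lemma taylor_add: "taylor s (a + b) = taylor s a + taylor s b"
proof -
  let ?K = "Poly_Mapping.keys a \<union> Poly_Mapping.keys b"
  show ?thesis
    by (subst (1 2 3) taylor_superset[of ?K])
      (auto simp: keys_add lookup_add single_add fps_const_add[symmetric] algebra_simps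
         sum.distrib simp del: fps_const_add)
qed

lemma taylor_0 [simp]: "taylor s 0 = 0"
  by (simp add: taylor_def)

lemma taylor_sum: "taylor s (\<Sum>i\<in>A. f i) = (\<Sum>i\<in>A. taylor s (f i))"
  by (induction A rule: infinite_finite_induct) (auto simp: taylor_add)

lemma taylor_single: "taylor s (Poly_Mapping.single w c) =
    fps_const (Poly_Mapping.single 0 c) * prod_list (map (taylor_letter s) (letters w))"
  by (subst taylor_superset[of "{w}"]) auto

text \<open>By bilinearity it suffices to treat two monomials. Their words concatenate, and only the
  scalar of the second has to pass the first word, which it may because constants are
  central.\<close>

lemma taylor_mult: "taylor s (a * b) = taylor s a * taylor s b"
proof -
  have *: "taylor s (Poly_Mapping.single u c * Poly_Mapping.single v d) =
    taylor s (Poly_Mapping.single u c) * taylor s (Poly_Mapping.single v d)" for u v :: "nat ncmonom" and c d :: 'a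
  proof -
    let ?w = "\<lambda>u :: nat ncmonom. prod_list (map (taylor_letter s) (letters u)) :: 'a ncpoly fps"
    have "taylor s (Poly_Mapping.single u c * Poly_Mapping.single v d)
      = fps_const (Poly_Mapping.single 0 c) * (fps_const (Poly_Mapping.single 0 d) * ?w u) * ?w v"
      by (simp add: mult_single taylor_single plus_ncmonom_def ac_simps
        flip: fps_const_mult mult.assoc)
        (simp add: mult_single)
    also have "\<dots> = taylor s (Poly_Mapping.single u c) * taylor s (Poly_Mapping.single v d)"
      by (simp add: fps_const_single_0_commute[of d] taylor_single mult.assoc)
    finally show ?thesis .
  qed
  let ?m = "\<lambda>a. \<Sum>w\<in>Poly_Mapping.keys a. Poly_Mapping.single w (Poly_Mapping.lookup a w)"
  have "taylor s (?m a * ?m b) = taylor s (?m a) * taylor s (?m b)"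
    by (simp add: sum_product taylor_sum *)
  then show ?thesis by (simp add: sum_single_lookup)
qed

lemma taylor_const: "taylor s (Poly_Mapping.single 0 c) = fps_const (Poly_Mapping.single 0 c)"
  by (simp add: taylor_single zero_ncmonom_def)

lemma taylor_ncvar: "taylor s (ncvar u) = taylor_letter s u"
  by (simp add: ncvar_def taylor_single single_one)

lemma hasse_add: "hasse s j (a + b) = hasse s j a + hasse s j b"
  by (simp add: hasse_def taylor_add)

lemma hasse_0 [simp]: "hasse s j 0 = 0"
  by (simp add: hasse_def)

lemma hasse_sum: "hasse s j (\<Sum>i\<in>A. f i) = (\<Sum>i\<in>A. hasse s j (f i))"
  by (simp add: hasse_def taylor_sum fps_sum_nth)

lemma hasse_uminus: "hasse s j (- a) = - hasse s j a"
  using hasse_add[of s j a "- a"] by (simp add: eq_neg_iff_add_eq_0 add.commute)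

lemma hasse_diff: "hasse s j (a - b) = hasse s j a - hasse s j b"
  using hasse_add[of s j a "- b"] by (simp add: hasse_uminus)

lemma hasse_mult: "hasse s j (a * b) = (\<Sum>i\<le>j. hasse s i a * hasse s (j - i) b)"
  by (simp add: hasse_def taylor_mult fps_mult_nth atLeast0AtMost)

lemma hasse_const_mult: "hasse s j (Poly_Mapping.single 0 c * a) = Poly_Mapping.single 0 c * hasse s j a"
  by (simp add: hasse_def taylor_mult taylor_const)

lemma hasse_scale: "hasse s j (scale_ncpoly c a) = scale_ncpoly c (hasse s j a)"
  by (simp add: scale_ncpoly_conv_mult hasse_const_mult)

lemma taylor_1: "taylor s 1 = 1"
  by (metis single_one taylor_const fps_const_1_eq_1)

lemma hasse_1: "hasse s j 1 = (if j = 0 then 1 else 0)"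
  by (simp add: hasse_def taylor_1)

lemma hasse_ncvar_mult: "hasse s j (ncvar u * a) = 
  ncvar u * hasse s j a + (if u = s \<and> j > 0 then hasse s (j - 1) a else 0)"
  by (simp add: hasse_def taylor_mult taylor_ncvar taylor_letter_def algebra_simps)

text \<open>For identities between linear operators: with this rule each reduces to its value at 1
  and to the recursion \<open>hasse_ncvar_mult\<close> for one more letter on the left.\<close>

lemma ncpoly_induct [case_names zero one add const_mult ncvar_mult]:
  fixes a :: "'k::field ncpoly"
  assumes "P 0" "P 1" and add: "\<And>a b. P a \<Longrightarrow> P b \<Longrightarrow> P (a + b)"
    and "\<And>c a. P a \<Longrightarrow> P (Poly_Mapping.single 0 c * a)"
    and "\<And>u a. P a \<Longrightarrow> P (ncvar u * a)"
  shows "P a"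
proof -
  have w: "P (Poly_Mapping.single (NCMonom w) 1)" for w
  proof (induction w)
    case Nil
    then show ?case using assms(2) by (simp flip: zero_ncmonom_def add: single_one)
  next
    case (Cons u w)
    then show ?case using assms(5)[of "Poly_Mapping.single (NCMonom w) 1" u]
      by (simp add: ncvar_def mult_single plus_ncmonom_def)
  qed
  have "P (Poly_Mapping.single w c)" for w and c
    using assms(4)[OF w[of "letters w"], of c] by (simp add: mult_single)
  then have "P (\<Sum>w\<in>K. Poly_Mapping.single w (Poly_Mapping.lookup a w))" for K
    using assms(1) add by (induction K rule: infinite_finite_induct) auto
  from this[of "Poly_Mapping.keys a"] show ?thesis
    by (simp add: sum_single_lookup)
qed

lemma hasse_at_0 [simp]: "hasse s 0 a = a"
  by (induction a rule: ncpoly_induct) (auto simp: hasse_1 hasse_add hasse_const_mult hasse_ncvar_mult)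

text \<open>The law of divided powers, as for (d^i/i!)(d^j/j!). Splitting off a letter x_s on the
  left turns it into Pascal's rule; it holds in every characteristic.\<close>

lemma hasse_hasse: "hasse s i (hasse s j a) = of_nat ((i + j) choose i) * hasse s (i + j) a"
proof (induction a arbitrary: i j rule: ncpoly_induct)
  case (ncvar_mult u a)
  have comm: "x * (of_nat n * y) = of_nat n * (x * y)" for x y :: "'a ncpoly" and n
    by (metis mult.assoc mult_of_nat_commute)
  show ?case
  proof (cases "u = s")
    case True
    then show ?thesis
      by (cases i; cases j) (simp_all add: hasse_ncvar_mult hasse_add ncvar_mult algebra_simps comm)
  next
    case False
    then show ?thesis by (simp add: hasse_ncvar_mult ncvar_mult comm)
  qed
next
  case (const_mult c a)
  then show ?case
    by (simp add: hasse_const_mult) (metis mult.assoc mult_of_nat_commute)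
qed (auto simp: hasse_1 hasse_add algebra_simps)

lemma hasse_commute: "hasse s i (hasse t j a) = hasse t j (hasse s i a)"
proof (cases "s = t")
  case True
  then show ?thesis by (simp add: hasse_hasse add.commute binomial_symmetric[of j "i + j"])
next
  case False
  then show ?thesis
    by (induction a arbitrary: i j rule: ncpoly_induct)
      (auto simp: hasse_1 hasse_add hasse_const_mult hasse_ncvar_mult)
qed

text \<open>The Leibniz rule with D^(l) x^j = C(j, l) x^(j-l). For l > j the truncated exponent is
  harmless because the binomial coefficient is 0.\<close>

lemma hasse_ncvar_power_mult:
  "hasse s i (ncvar s ^ j * a) = (\<Sum>l\<le>i. of_nat (j choose l) * (ncvar s ^ (j - l) * hasse s (i - l) a))"
proof (induction j arbitrary: i)
  case 0
  have "hasse s i a = (\<Sum>l\<le>i. if l = 0 then hasse s (i - l) a else 0)"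
    by simp
  also have "\<dots> = (\<Sum>l\<le>i. of_nat (0 choose l) * (ncvar s ^ (0 - l) * hasse s (i - l) a))"
    by (rule sum.cong) (auto simp: binomial_eq_0)
  finally show ?case by simp
next
  case (Suc j)
  show ?case
  proof (cases i)
    case (Suc i')
    have comm: "x * (of_nat n * y) = of_nat n * (x * y)" for x y :: "'a ncpoly" and n
      by (metis mult.assoc mult_of_nat_commute)
    let ?x = "ncvar s :: 'a ncpoly"
    \<comment> \<open>The exponents \<open>Suc (j - Suc l)\<close> and \<open>j - l\<close> differ
      when l >= j, but then the coefficient is 0.\<close>
    have *: "of_nat (j choose Suc l) * (?x ^ Suc (j - Suc l) * b) = of_nat (j choose Suc l) * (?x ^ (j - l) * b)" for l b
      by (cases "l < j") (simp_all add: Suc_diff_Suc binomial_eq_0 del: power_Suc)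
    have "hasse s i (?x ^ Suc j * a) = ?x * hasse s i (?x ^ j * a) + hasse s i' (?x ^ j * a)"
      by (simp add: mult.assoc hasse_ncvar_mult Suc)
    also have "?x * hasse s i (?x ^ j * a) = (\<Sum>l\<le>i. of_nat (j choose l) * (?x ^ Suc (j - l) * hasse s (i - l) a))"
      by (simp add: Suc.IH sum_distrib_left comm mult.assoc)
    also have "\<dots> = ?x ^ Suc j * hasse s i a + (\<Sum>l\<le>i'. of_nat (j choose Suc l) * (?x ^ (j - l) * hasse s (i' - l) a))"
      unfolding Suc by (subst sum.atMost_Suc_shift)
        (simp only: * diff_Suc_Suc binomial_n_0 of_nat_1 mult_1_left diff_zero)
    also have "\<dots> + hasse s i' (?x ^ j * a) = ?x ^ Suc j * hasse s i a + (\<Sum>l\<le>i'. of_nat (Suc j choose Suc l) * (?x ^ (j - l) * hasse s (i' - l) a))"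
      by (simp add: Suc.IH algebra_simps sum.distrib)
    also have "\<dots> = (\<Sum>l\<le>i. of_nat (Suc j choose l) * (?x ^ (Suc j - l) * hasse s (i - l) a))"
      unfolding Suc by (subst sum.atMost_Suc_shift) (simp del: power_Suc binomial_Suc_Suc)
    finally show ?thesis .
  qed simp
qed

lemma hasse_ncvar_power_mult_other:
  assumes "s \<noteq> t"
  shows "hasse t i (ncvar s ^ j * a) = ncvar s ^ j * hasse t i a"
  using assms by (induction j) (simp_all add: hasse_ncvar_mult mult.assoc)

section \<open>Descent along one variable\<close>

text \<open>From k C(p^e, k) = p^e C(p^e - 1, k - 1): if p did not divide C(p^e, k), then p^e would
  divide k, which is positive and smaller.\<close>

lemma prime_dvd_choose_prime_power:
  assumes "prime (p::nat)" "0 < k" "k < p ^ e"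
  shows "p dvd (p ^ e choose k)"
proof (rule ccontr)
  assume "\<not> p dvd (p ^ e choose k)"
  then have "coprime (p ^ e) (p ^ e choose k)"
    using assms(1) by (simp add: prime_imp_coprime)
  moreover have "p ^ e dvd k * (p ^ e choose k)"
    by (simp add: times_binomial_minus1_eq[OF assms(2)])
  ultimately have "p ^ e dvd k"
    by (simp add: coprime_dvd_mult_left_iff)
  then show False using assms(2,3) by (auto dest: dvd_imp_le)
qed

text \<open>The case of Kummer's theorem in which adding a and b in base p carries out of the top
  digit. Write a + b = p^e + c with c < a and apply Vandermonde: the term k = 0 contains C(c, a) =
  0, the others contain C(p^e, k) with 0 < k < p^e.\<close>

lemma prime_dvd_choose_carry:
  assumes "prime (p::nat)" "a < p ^ e" "b < p ^ e" "p ^ e \<le> a + b"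
  shows "p dvd ((a + b) choose a)"
proof -
  define c where "c = a + b - p ^ e"
  have c: "a + b = p ^ e + c" "c < a" using assms by (auto simp: c_def)
  have "p dvd (p ^ e choose k) * (c choose (a - k))" if "k \<le> a" for k
  proof (cases "k = 0")
    case True
    then show ?thesis using c(2) by (simp add: binomial_eq_0)
  next
    case False
    then show ?thesis using prime_dvd_choose_prime_power[OF assms(1), of k e] that assms(2) by simp
  qed
  then show ?thesis
    unfolding c(1) vandermonde[symmetric] by (intro dvd_sum) auto
qed

lemma of_int_ncpoly: "(of_int c :: 'k::field ncpoly) = Poly_Mapping.single 0 (of_int c)"
  by (rule single_of_int[symmetric])

lemma of_nat_ncpoly_eq_0:
  assumes "CHAR('k::field) dvd m"
  shows "(of_nat m :: 'k ncpoly) = 0"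
  using assms by (metis of_nat_eq_0_iff_char_dvd single_of_nat single_zero)

lemma of_int_left_commute: "x * (of_int c * y) = of_int c * (x * y)" for x y :: "'a::ring_1"
  by (metis mult.assoc mult_of_int_commute)

lemma of_int_mult_assoc: "of_int c * (of_int d * y) = of_int (c * d) * y" for y :: "'a::ring_1"
  by (simp add: mult.assoc)

lemma hasse_of_int_mult: "hasse s j (of_int c * a) = of_int c * hasse s j a"
  by (simp only: of_int_ncpoly hasse_const_mult)

text \<open>The truncated Taylor expansion of \<open>a\<close> at \<open>x\<^sub>s - x\<^sub>s\<close>.\<close>

definition hasse_proj :: "nat \<Rightarrow> nat \<Rightarrow> 'k::field ncpoly \<Rightarrow> 'k ncpoly"
  where "hasse_proj s q a = (\<Sum>j<q. of_int ((-1) ^ j) * (ncvar s ^ j * hasse s j a))"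

lemma hasse_proj_add: "hasse_proj s q (a + b) = hasse_proj s q a + hasse_proj s q b"
  by (simp add: hasse_proj_def hasse_add algebra_simps sum.distrib)

lemma hasse_proj_0 [simp]: "hasse_proj s q 0 = 0"
  by (simp add: hasse_proj_def)

lemma hasse_proj_sum: "hasse_proj s q (\<Sum>i\<in>A. f i) = (\<Sum>i\<in>A. hasse_proj s q (f i))"
  by (induction A rule: infinite_finite_induct) (auto simp: hasse_proj_add)

lemma single_0_left_commute:
  "y * (Poly_Mapping.single 0 c * b) = Poly_Mapping.single 0 c * (y * b)" for y b :: "'k::field ncpoly"
  unfolding mult.assoc[symmetric] single_0_commute[of c y] ..

lemma hasse_proj_const_mult:
  "hasse_proj s q (Poly_Mapping.single 0 c * a) = Poly_Mapping.single 0 c * hasse_proj s q a"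
  unfolding hasse_proj_def sum_distrib_left hasse_const_mult
  by (simp only: single_0_left_commute[of _ c])

lemma hasse_proj_of_int_mult: "hasse_proj s q (of_int c * a) = of_int c * hasse_proj s q a"
  by (simp only: of_int_ncpoly hasse_proj_const_mult)

lemma hasse_proj_scale: "hasse_proj s q (scale_ncpoly c a) = scale_ncpoly c (hasse_proj s q a)"
  by (simp add: scale_ncpoly_conv_mult hasse_proj_const_mult)

lemma hasse_proj_hasse_other:
  assumes "s \<noteq> t"
  shows "hasse t i (hasse_proj s q a) = hasse_proj s q (hasse t i a)"
  unfolding hasse_proj_def hasse_sum hasse_of_int_mult hasse_ncvar_power_mult_other[OF assms]
  by (simp add: hasse_commute)

lemma hasse_hasse': "hasse s i (hasse s j a) = of_int (int ((i + j) choose i)) * hasse s (i + j) a"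
  by (simp add: hasse_hasse)

lemma hasse_ncvar_power_mult':
  "hasse s i (ncvar s ^ j * a) = (\<Sum>l\<le>i. of_int (int (j choose l)) * (ncvar s ^ (j - l) * hasse s (i - l) a))"
  by (simp add: hasse_ncvar_power_mult)

lemma alternating_choose_sum: "(\<Sum>i\<le>m. (-1) ^ i * int (m choose i)) = (if m = 0 then 1 else 0)"
  using choose_alternating_sum[of m, where 'a = int] by auto

section \<open>Exact identities for the projection onto the kernel\<close>

context
  fixes q :: nat
  assumes q_pos: "q > 0"
    and carry: "\<And>a b. a < q \<Longrightarrow> b < q \<Longrightarrow> q \<le> a + b \<Longrightarrow>
      (of_int (int ((a + b) choose a)) :: 'k::field ncpoly) = 0"
begin

text \<open>With m = i + j the double sum collects x^m D^(m) a with coefficient the alternating sum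
  of the C(m, i), which is 0 unless m = 0. The square i, j < q contains complete diagonals only for
  m < q; on the remaining corner every coefficient vanishes by \<open>carry\<close>.\<close>

lemma hasse_proj_expansion: "(\<Sum>j<q. ncvar s ^ j * hasse_proj s q (hasse s j a)) = a"
  for a :: "'k ncpoly"
proof -
  let ?T = "\<lambda>i m. of_int ((-1) ^ i * int (m choose i)) * (ncvar s ^ m * hasse s m a)"
  have "ncvar s ^ j * (of_int ((-1) ^ i) * (ncvar s ^ i * hasse s i (hasse s j a))) =
    ?T i (i + j)" for i j
    unfolding hasse_hasse' of_int_left_commute[of "ncvar s ^ k" for k] of_int_mult_assoc
    by (simp only: power_add mult.assoc add.commute[of i j])
  then have "(\<Sum>j<q. ncvar s ^ j * hasse_proj s q (hasse s j a)) = (\<Sum>j<q. \<Sum>i<q. ?T i (i + j))"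
    unfolding hasse_proj_def sum_distrib_left by simp
  also have "\<dots> = (\<Sum>(i, j)\<in>{..<q} \<times> {..<q}. ?T i (i + j))"
    by (subst sum.swap) (simp add: sum.cartesian_product)
  also have "\<dots> = (\<Sum>(i, j)\<in>{(i, j). i + j < q}. ?T i (i + j))"
  proof (rule sum.mono_neutral_right)
    have "of_int ((-1) ^ i * int ((i + j) choose i)) = (0 :: 'k ncpoly)" if "i < q" "j < q" "q \<le> i + j" for i j
      using carry[OF that] by simp
    then show "\<forall>z \<in> {..<q} \<times> {..<q} - {(i, j). i + j < q}. (case z of (i, j) \<Rightarrow> ?T i (i + j)) = 0"
      by (auto simp only: not_less mem_Collect_eq split: prod.splits) auto
  qed auto
  also have "\<dots> = (\<Sum>m<q. \<Sum>i\<le>m. ?T i m)"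
    by (subst sum.triangle_reindex) simp
  also have "\<dots> = (\<Sum>m<q. if m = 0 then a else 0)"
    by (intro sum.cong refl)
      (simp add: alternating_choose_sum flip: sum_distrib_right of_int_sum
        del: of_int_mult of_int_power of_int_minus)
  finally show ?thesis using q_pos by simp
qed

text \<open>Leibniz and the divided power law give terms in x^(j-l) D^(i-l+j) a. Collected by m = j
  - l, the coefficient factors into a part free of l and the alternating sum of the C(i, l), which
  is 0 because i > 0.\<close>

lemma hasse_hasse_proj:
  fixes a :: "'k ncpoly"
  assumes "0 < i" "i < q"
  shows "hasse s i (hasse_proj s q a) = 0"
proof -
  let ?T = "\<lambda>j l. of_int ((-1) ^ j * (int (j choose l) * int (((i - l) + j) choose (i - l)))) *
    (ncvar s ^ (j - l) * hasse s (i - l + j) a)"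
  have "hasse s i (hasse_proj s q a) = (\<Sum>l\<le>i. \<Sum>j<q. ?T j l)"
    unfolding hasse_proj_def hasse_sum hasse_of_int_mult hasse_ncvar_power_mult' hasse_hasse'
    by (subst sum.swap) (simp add: sum_distrib_left of_int_left_commute[of "ncvar s ^ k" for k] of_int_mult_assoc
      del: of_int_mult of_int_power of_int_minus of_int_of_nat_eq)
  also have "\<dots> = (\<Sum>l\<le>i. \<Sum>m<q - i. of_int ((-1) ^ m * int ((i + m) choose m) * ((-1) ^ l * int (i choose l))) * (ncvar s ^ m * hasse s (i + m) a))"
  proof (rule sum.cong[OF refl])
    fix l assume l: "l \<in> {..i}"
    \<comment> \<open>Only l <= j < q - i + l contributes: below this range C(j, l) = 0, above it (i
      - l) + j >= q and \<open>carry\<close> applies. The substitution j = m + l then gives m a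
      range independent of l.\<close>
    have "(\<Sum>j<q. ?T j l) = (\<Sum>j=0+l..<(q - i)+l. ?T j l)"
    proof (rule sum.mono_neutral_right)
      show "\<forall>j\<in>{..<q} - {0 + l..<q - i + l}. ?T j l = 0"
      proof
        fix j assume j: "j \<in> {..<q} - {0 + l..<q - i + l}"
        show "?T j l = 0"
        proof (cases "j < l")
          case False
          with j l assms have "of_int (int ((i - l + j) choose (i - l))) = (0 :: 'k ncpoly)"
            by (intro carry) auto
          then show ?thesis by simp
        qed (simp add: binomial_eq_0)
      qed
    qed (use l assms in auto)
    also have "\<dots> = (\<Sum>m<q - i. ?T (m + l) l)"
      by (subst sum.shift_bounds_nat_ivl) (simp add: atLeast0LessThan)
    also have "\<dots> = (\<Sum>m<q - i. of_int ((-1) ^ m * int ((i + m) choose m) * ((-1) ^ l * int (i choose l))) * (ncvar s ^ m * hasse s (i + m) a))"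
    proof (rule sum.cong[OF refl])
      fix m
      \<comment> \<open>Both sides are the multinomial coefficient of i + m into parts m, l and i -
        l; this separates l from m.\<close>
      have "((m + l) choose l) * ((i + m) choose (i - l)) = ((i + m) choose m) * (i choose l)"
        using choose_mult[of m "m + l" "i + m"] l binomial_symmetric[of l "m + l"] binomial_symmetric[of "i - l" "i + m"]
        by (simp add: add.commute mult.commute)
      then have "int ((m + l) choose l) * int ((i + m) choose (i - l)) = int ((i + m) choose m) * int (i choose l)"
        by (metis of_nat_mult)
      then have "(-1) ^ (m + l) * (int ((m + l) choose l) * int ((i + m) choose (i - l))) = 
         (-1) ^ m * int ((i + m) choose m) * ((-1) ^ l * int (i choose l))"
        by (simp add: power_add)
      then show "?T (m + l) l = of_int ((-1) ^ m * int ((i + m) choose m) * ((-1) ^ l * int (i choose l))) * (ncvar s ^ m * hasse s (i + m) a)"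
        using l by (simp del: of_int_mult of_int_power of_int_minus)
    qed
    finally show "(\<Sum>j<q. ?T j l) = \<dots>" .
  qed
  also have "\<dots> = 0"
    by (subst sum.swap)
      (use assms(1) in \<open>simp add: alternating_choose_sum del: of_int_mult of_int_power of_int_minus
        flip: sum_distrib_right sum_distrib_left of_int_sum\<close>)
  finally show ?thesis .
qed

end

text \<open>The properties of the preimage of some M_i(A) that suffice to compute modulo it. In the
  statements below b represents an element of the kernel in the quotient: its derivatives of orders
  1 to q - 1 are in W but need not be 0.\<close>

locale hasse_stable =
  fixes s q :: nat and W :: "'k::field ncpoly set"
  assumes zero_mem [simp]: "0 \<in> W"
    and add_mem: "a \<in> W \<Longrightarrow> b \<in> W \<Longrightarrow> a + b \<in> W"
    and uminus_mem: "a \<in> W \<Longrightarrow> - a \<in> W"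
    and ncvar_mult_mem: "a \<in> W \<Longrightarrow> ncvar s * a \<in> W"
    and hasse_mem: "a \<in> W \<Longrightarrow> j < q \<Longrightarrow> hasse s j a \<in> W"
begin

lemma diff_mem: "a \<in> W \<Longrightarrow> b \<in> W \<Longrightarrow> a - b \<in> W"
  using add_mem[OF _ uminus_mem, of a b] by simp

lemma sum_mem: "(\<And>i. i \<in> A \<Longrightarrow> f i \<in> W) \<Longrightarrow> sum f A \<in> W"
  by (induction A rule: infinite_finite_induct) (auto intro: add_mem)

lemma of_int_mult_mem: "a \<in> W \<Longrightarrow> of_int c * a \<in> W"
proof -
  assume a: "a \<in> W"
  have n: "of_nat k * a \<in> W" for k
    by (induction k) (auto simp: algebra_simps intro: add_mem a)
  show ?thesis
  proof (cases "c \<ge> 0")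
    case True
    then show ?thesis using n[of "nat c"] by simp
  next
    case False
    then show ?thesis using uminus_mem[OF n[of "nat (- c)"]] by simp
  qed
qed

lemma ncvar_power_mult_mem: "a \<in> W \<Longrightarrow> ncvar s ^ j * a \<in> W"
  by (induction j) (auto simp: mult.assoc intro: ncvar_mult_mem)

lemma hasse_proj_mem: "a \<in> W \<Longrightarrow> hasse_proj s q a \<in> W"
  unfolding hasse_proj_def
  by (intro sum_mem of_int_mult_mem ncvar_power_mult_mem hasse_mem) auto

text \<open>In the Leibniz sum every term with l < i differentiates b and hence lies in W; the term
  l = i is left.\<close>

lemma hasse_ncvar_power_mult_cong:
  assumes b: "\<And>l. 0 < l \<Longrightarrow> l < q \<Longrightarrow> hasse s l b \<in> W" and i: "i < q"
  shows "hasse s i (ncvar s ^ j * b) - of_int (int (j choose i)) * (ncvar s ^ (j - i) * b) \<in> W"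
proof -
  have "hasse s i (ncvar s ^ j * b) - of_int (int (j choose i)) * (ncvar s ^ (j - i) * b) =
    (\<Sum>l<i. of_int (int (j choose l)) * (ncvar s ^ (j - l) * hasse s (i - l) b))"
    unfolding hasse_ncvar_power_mult' lessThan_Suc_atMost[symmetric] by simp
  also have "\<dots> \<in> W"
    by (intro sum_mem of_int_mult_mem ncvar_power_mult_mem b) (use i in auto)
  finally show ?thesis .
qed

text \<open>Modulo W the projection multiplies x^m b by the alternating sum of the C(m, k), that is
  by (1 - 1)^m.\<close>

lemma hasse_proj_ncvar_power_mult_cong:
  assumes b: "\<And>l. 0 < l \<Longrightarrow> l < q \<Longrightarrow> hasse s l b \<in> W" and m: "m < q"
  shows "hasse_proj s q (ncvar s ^ m * b) - (if m = 0 then b else 0) \<in> W"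
proof -
  let ?x = "ncvar s :: 'k ncpoly"
  let ?c = "\<lambda>k. (-1) ^ k * int (m choose k)"
  have "(\<Sum>k<q. of_int ((-1) ^ k) * (?x ^ k * (of_int (int (m choose k)) * (?x ^ (m - k) * b)))) =
    (\<Sum>k<q. of_int (?c k) * (?x ^ m * b))"
  proof (rule sum.cong[OF refl])
    fix k
    show "of_int ((-1) ^ k) * (?x ^ k * (of_int (int (m choose k)) * (?x ^ (m - k) * b))) =
      of_int (?c k) * (?x ^ m * b)"
    proof (cases "k \<le> m")
      case True
      then have "?x ^ m = ?x ^ k * ?x ^ (m - k)"
        by (simp flip: power_add)
      then show ?thesis
        by (simp only: of_int_left_commute[of "?x ^ k"] of_int_mult_assoc mult.assoc)
    qed (simp add: binomial_eq_0)
  qed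
  \<comment> \<open>Here m < q is used: the truncated sum contains the whole row k <= m of binomial
    coefficients.\<close>
  also have "\<dots> = (\<Sum>k\<le>m. of_int (?c k) * (?x ^ m * b))"
    by (rule sum.mono_neutral_right) (use m in \<open>auto simp: binomial_eq_0\<close>)
  also have "\<dots> = (if m = 0 then b else 0)"
    by (simp add: alternating_choose_sum flip: sum_distrib_right of_int_sum
        del: of_int_mult of_int_power of_int_minus)
  finally have "hasse_proj s q (?x ^ m * b) - (if m = 0 then b else 0) =
    (\<Sum>k<q. of_int ((-1) ^ k) * (?x ^ k *
      (hasse s k (?x ^ m * b) - of_int (int (m choose k)) * (?x ^ (m - k) * b))))"
    by (simp add: hasse_proj_def right_diff_distrib sum_subtractf)
  also have "\<dots> \<in> W"
    by (intro sum_mem of_int_mult_mem ncvar_power_mult_mem hasse_ncvar_power_mult_cong b) auto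
  finally show ?thesis .
qed

text \<open>P D^(i) is the coefficient functional of x^i: from a sum of x^j b_j with the b_j in the
  kernel it recovers b_i modulo W. This makes the decomposition direct.\<close>

lemma hasse_proj_hasse_ncvar_power_mult_cong:
  assumes b: "\<And>l. 0 < l \<Longrightarrow> l < q \<Longrightarrow> hasse s l b \<in> W" and ij: "i < q" "j < q"
  shows "hasse_proj s q (hasse s i (ncvar s ^ j * b)) - (if i = j then b else 0) \<in> W"
proof -
  let ?x = "ncvar s :: 'k ncpoly"
  let ?y = "of_int (int (j choose i)) * (?x ^ (j - i) * b)"
  have "hasse_proj s q (hasse s i (?x ^ j * b)) - (if i = j then b else 0) =
     hasse_proj s q (hasse s i (?x ^ j * b) - ?y) + (hasse_proj s q ?y - (if i = j then b else 0))"
    using hasse_proj_add[of s q "hasse s i (?x ^ j * b) - ?y" ?y] by simp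
  \<comment> \<open>For i > j truncated subtraction also gives j - i = 0, but there C(j, i) = 0, so
    the two sides still agree.\<close>
  moreover have "hasse_proj s q ?y - (if i = j then b else 0) =
     of_int (int (j choose i)) * (hasse_proj s q (?x ^ (j - i) * b) - (if j - i = 0 then b else 0))"
    by (cases i j rule: linorder_cases)
      (auto simp: hasse_proj_of_int_mult binomial_eq_0 simp del: of_int_of_nat_eq)
  moreover have "hasse_proj s q (hasse s i (?x ^ j * b) - ?y) \<in> W"
    by (intro hasse_proj_mem hasse_ncvar_power_mult_cong b ij)
  moreover have "of_int (int (j choose i)) *
      (hasse_proj s q (?x ^ (j - i) * b) - (if j - i = 0 then b else 0)) \<in> W"
    by (intro of_int_mult_mem hasse_proj_ncvar_power_mult_cong b) (use ij in auto)
  ultimately show ?thesis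
    by (simp only: add_mem)
qed

end

section \<open>Multidegrees under Hasse derivatives and left multiplication\<close>

lemma keys_ncvar: "Poly_Mapping.keys (ncvar u :: 'k::field ncpoly) = {NCMonom [u]}"
  by (simp add: ncvar_def)

text \<open>D^(j) turns a word into the sum of the words obtained by deleting j of its letters s.
  The degree law is written with addition, so that it also excludes j larger than the number of
  letters s.\<close>

lemma keys_hasse_single:
  fixes w :: "nat list"
  assumes "w' \<in> Poly_Mapping.keys (hasse s j (Poly_Mapping.single (NCMonom w) (1::'k::field)))"
  shows "set (letters w') \<subseteq> set w \<and>
    (\<forall>t. degree_in t w' + (if t = s then j else 0) = count_list w t)"
  using assms
proof (induction w arbitrary: w' j)
  case Nil
  have "letters (0 :: nat ncmonom) = []"
    by (simp add: zero_ncmonom_def)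
  with Nil show ?case
    by (auto simp: hasse_1 degree_in_def simp flip: zero_ncmonom_def split: if_splits)
next
  case (Cons u w)
  let ?a = "Poly_Mapping.single (NCMonom w) (1::'k)"
  have eq: "Poly_Mapping.single (NCMonom (u # w)) (1::'k) = ncvar u * ?a"
    by (simp add: ncvar_def mult_single plus_ncmonom_def)
  from Cons.prems have "w' \<in> Poly_Mapping.keys (ncvar u * hasse s j ?a) \<or>
     w' \<in> Poly_Mapping.keys (if u = s \<and> j > 0 then hasse s (j - 1) ?a else 0)"
    using subsetD[OF keys_add] by (simp only: eq hasse_ncvar_mult Un_iff)
  then show ?case
  proof
    assume "w' \<in> Poly_Mapping.keys (ncvar u * hasse s j ?a)"
    then obtain v where v: "v \<in> Poly_Mapping.keys (hasse s j ?a)" and w': "letters w' = u # letters v"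
      by (rule keys_mult_ncpoly) (auto simp: keys_ncvar)
    show ?thesis
      using Cons.IH[OF v] by (auto simp: w' degree_in_def)
  next
    assume *: "w' \<in> Poly_Mapping.keys (if u = s \<and> j > 0 then hasse s (j - 1) ?a else 0)"
    then have "u = s" "j > 0" and "w' \<in> Poly_Mapping.keys (hasse s (j - 1) ?a)"
      by (auto split: if_splits)
    then show ?thesis
      using Cons.IH[of w' "j - 1"] by (auto simp: degree_in_def split: if_splits)
  qed
qed

lemma keys_hasse:
  fixes a :: "'k::field ncpoly"
  assumes "w' \<in> Poly_Mapping.keys (hasse s j a)"
  obtains w where "w \<in> Poly_Mapping.keys a" "set (letters w') \<subseteq> set (letters w)"
    "\<And>t. degree_in t w' + (if t = s then j else 0) = degree_in t w"
proof -
  have "hasse s j a = hasse s j (\<Sum>w\<in>Poly_Mapping.keys a. Poly_Mapping.single w (Poly_Mapping.lookup a w))"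
    by (simp add: sum_single_lookup)
  also have "\<dots> = (\<Sum>w\<in>Poly_Mapping.keys a. hasse s j (Poly_Mapping.single 0 (Poly_Mapping.lookup a w) *
      Poly_Mapping.single (NCMonom (letters w)) 1))"
    by (simp add: hasse_sum mult_single)
  also have "\<dots> = (\<Sum>w\<in>Poly_Mapping.keys a. scale_ncpoly (Poly_Mapping.lookup a w)
      (hasse s j (Poly_Mapping.single (NCMonom (letters w)) 1)))"
    by (simp only: hasse_const_mult scale_ncpoly_conv_mult)
  finally have "(\<Sum>w\<in>Poly_Mapping.keys a. Poly_Mapping.lookup a w *
      Poly_Mapping.lookup (hasse s j (Poly_Mapping.single (NCMonom (letters w)) 1)) w') \<noteq> 0"
    using assms by (simp add: in_keys_iff lookup_sum)
  then obtain w where "w \<in> Poly_Mapping.keys a"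
    "Poly_Mapping.lookup (hasse s j (Poly_Mapping.single (NCMonom (letters w)) (1::'k))) w' \<noteq> 0"
    by (elim sum.not_neutral_contains_not_neutral) auto
  with keys_hasse_single[of w' s j "letters w", where 'k = 'k] that show ?thesis
    by (auto simp: in_keys_iff degree_in_def)
qed

lemma keys_ncvar_power_mult:
  fixes a :: "'k::field ncpoly"
  assumes "w' \<in> Poly_Mapping.keys (ncvar s ^ j * a)"
  obtains w where "w \<in> Poly_Mapping.keys a" "set (letters w') \<subseteq> insert s (set (letters w))"
    "\<And>t. degree_in t w' = degree_in t w + (if t = s then j else 0)"
proof -
  have "\<exists>w\<in>Poly_Mapping.keys a. set (letters w') \<subseteq> insert s (set (letters w)) \<and>
    (\<forall>t. degree_in t w' = degree_in t w + (if t = s then j else 0))"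
    using assms
  proof (induction j arbitrary: w')
    case (Suc j)
    then have "w' \<in> Poly_Mapping.keys (ncvar s * (ncvar s ^ j * a))"
      by (simp add: mult.assoc)
    then obtain v where v: "v \<in> Poly_Mapping.keys (ncvar s ^ j * a)" and w': "letters w' = s # letters v"
      by (rule keys_mult_ncpoly) (auto simp: keys_ncvar)
    from Suc.IH[OF v] show ?case by (auto simp: w' degree_in_def)
  qed auto
  with that show ?thesis by blast
qed

lemma hasse_eq_0:
  assumes "a \<in> free_component n r d" "s \<in> {1..r}" "Poly_Mapping.lookup d s < j"
  shows "hasse s j a = 0"
proof (rule ccontr)
  assume "hasse s j a \<noteq> 0"
  then obtain w' where "w' \<in> Poly_Mapping.keys (hasse s j a)"
    by (metis keys_eq_empty ex_in_conv)
  then obtain w where w: "w \<in> Poly_Mapping.keys a"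
    and deg: "\<And>t. degree_in t w' + (if t = s then j else 0) = degree_in t w"
    by (rule keys_hasse) (rule that)
  have "degree_in s w = Poly_Mapping.lookup d s"
    using assms w by (simp add: free_component_def)
  with deg[of s] assms(3) show False by simp
qed

text \<open>The truncated subtraction is harmless: for s in {1..r} and j above the degree no word
  survives, and for s outside {1..r} the degrees that are tested do not change.\<close>

lemma hasse_free_component:
  assumes "a \<in> free_component n r d"
  shows "hasse s j a \<in> free_component n r (d - Poly_Mapping.single s j)"
proof -
  have "set (letters w') \<subseteq> {1..n} \<and>
    (\<forall>t\<in>{1..r}. degree_in t w' = Poly_Mapping.lookup (d - Poly_Mapping.single s j) t)"
    if w': "w' \<in> Poly_Mapping.keys (hasse s j a)" for w'
  proof -
    obtain w where w: "w \<in> Poly_Mapping.keys a" "set (letters w') \<subseteq> set (letters w)"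
      and deg: "\<And>t. degree_in t w' + (if t = s then j else 0) = degree_in t w"
      using w' by (rule keys_hasse) (rule that)
    have "degree_in t w' = Poly_Mapping.lookup (d - Poly_Mapping.single s j) t" if "t \<in> {1..r}" for t
    proof -
      have "degree_in t w = Poly_Mapping.lookup d t"
        using assms w(1) that by (simp add: free_component_def)
      then show ?thesis using deg[of t]
        by (cases "t = s") (simp_all add: lookup_minus lookup_single)
    qed
    moreover have "set (letters w) \<subseteq> {1..n}"
      using assms w(1) by (simp add: free_component_def free_algebra_def)
    ultimately show ?thesis using w(2) by auto
  qed
  then show ?thesis by (simp add: free_component_def free_algebra_def)
qed

lemma ncvar_power_mult_free_component:
  assumes "a \<in> free_component n r d" "s \<in> {1..n}"
  shows "ncvar s ^ j * a \<in> free_component n r (d + Poly_Mapping.single s j)"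
proof -
  have "set (letters w') \<subseteq> {1..n} \<and>
    (\<forall>t\<in>{1..r}. degree_in t w' = Poly_Mapping.lookup (d + Poly_Mapping.single s j) t)"
    if w': "w' \<in> Poly_Mapping.keys (ncvar s ^ j * a)" for w'
  proof -
    obtain w where w: "w \<in> Poly_Mapping.keys a" "set (letters w') \<subseteq> insert s (set (letters w))"
      and deg: "\<And>t. degree_in t w' = degree_in t w + (if t = s then j else 0)"
      using w' by (rule keys_ncvar_power_mult) (rule that)
    have "degree_in t w' = Poly_Mapping.lookup (d + Poly_Mapping.single s j) t" if "t \<in> {1..r}" for t
    proof -
      have "degree_in t w = Poly_Mapping.lookup d t"
        using assms(1) w(1) that by (simp add: free_component_def)
      then show ?thesis using deg[of t]
        by (cases "t = s") (simp_all add: lookup_add lookup_single)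
    qed
    moreover have "set (letters w) \<subseteq> {1..n}"
      using assms(1) w(1) by (simp add: free_component_def free_algebra_def)
    ultimately show ?thesis using w(2) assms(2) by auto
  qed
  then show ?thesis by (simp add: free_component_def free_algebra_def)
qed

lemma free_component_add:
  "a \<in> free_component n r d \<Longrightarrow> b \<in> free_component n r d \<Longrightarrow> a + b \<in> free_component n r d"
  using keys_add[of a b] unfolding free_component_def free_algebra_def by fastforce

lemma free_component_0: "0 \<in> free_component n r d"
  unfolding free_component_def free_algebra_def by simp

lemma free_component_scale: "a \<in> free_component n r d \<Longrightarrow> scale_ncpoly c a \<in> free_component n r d"
  unfolding free_component_def free_algebra_def by (auto simp: in_keys_iff)

lemma free_component_sum:
  "(\<And>i. i \<in> A \<Longrightarrow> f i \<in> free_component n r d) \<Longrightarrow> sum f A \<in> free_component n r d"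
  by (induction A rule: infinite_finite_induct) (auto intro: free_component_add free_component_0)

lemma hasse_proj_free_component:
  assumes "a \<in> free_component n r d" "s \<in> {1..r}" "r \<le> n"
  shows "hasse_proj s q a \<in> free_component n r d"
  unfolding hasse_proj_def of_int_ncpoly scale_ncpoly_conv_mult[symmetric]
proof (intro free_component_sum free_component_scale)
  fix j
  show "ncvar s ^ j * hasse s j a \<in> free_component n r d"
  \<comment> \<open>Multiplying by x^j restores the degree only while j does not exceed the degree
    in x_s; beyond it truncation would change d, but there the derivative is 0.\<close>
  proof (cases "j \<le> Poly_Mapping.lookup d s")
    case True
    then have "d - Poly_Mapping.single s j + Poly_Mapping.single s j = d"
      by (intro poly_mapping_eqI) (auto simp: lookup_add lookup_minus lookup_single when_def)
    with ncvar_power_mult_free_component[OF hasse_free_component[OF assms(1), of s j], of s j] assms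
    show ?thesis by simp
  next
    case False
    then show ?thesis using hasse_eq_0[OF assms(1,2), of j] by (simp add: free_component_0)
  qed
qed

section \<open>Bases modulo a subspace\<close>

text \<open>Linear independence of the images in the quotient by W, expressed through
  representatives. Finiteness is included because these sets serve to count dimensions.\<close>

definition independent_mod ::
    "('a::field \<Rightarrow> 'b::ab_group_add \<Rightarrow> 'b) \<Rightarrow> 'b set \<Rightarrow> 'b set \<Rightarrow> bool"
  where "independent_mod scale W B \<longleftrightarrow>
    finite B \<and> (\<forall>c. (\<Sum>b\<in>B. scale (c b) b) \<in> W \<longrightarrow> (\<forall>b\<in>B. c b = 0))"

definition basis_mod ::
    "('a::field \<Rightarrow> 'b::ab_group_add \<Rightarrow> 'b) \<Rightarrow> 'b set \<Rightarrow> 'b set \<Rightarrow> 'b set \<Rightarrow> bool"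
  where "basis_mod scale U W B \<longleftrightarrow> independent_mod scale W B \<and> B \<subseteq> U \<and>
    (\<forall>u\<in>U. \<exists>c. u - (\<Sum>b\<in>B. scale (c b) b) \<in> W)"

lemma independent_modD:
  "independent_mod scale W B \<Longrightarrow> (\<Sum>b\<in>B. scale (c b) b) \<in> W \<Longrightarrow> b \<in> B \<Longrightarrow> c b = 0"
  by (auto simp: independent_mod_def)

text \<open>Turns an indexed family into a basis set without losing the count. The family in
  question consists of the products x^j b, for which distinctness is not evident in advance.\<close>

lemma (in vector_space) basis_mod_family:
  fixes v :: "'i \<Rightarrow> 'b"
  assumes fin: "finite K" and U: "\<And>k. k \<in> K \<Longrightarrow> v k \<in> U" and W: "0 \<in> W"
    and span: "\<And>u. u \<in> U \<Longrightarrow> \<exists>c. u - (\<Sum>k\<in>K. scale (c k) (v k)) \<in> W"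
    and indep: "\<And>c k. (\<Sum>k\<in>K. scale (c k) (v k)) \<in> W \<Longrightarrow> k \<in> K \<Longrightarrow> c k = 0"
  shows "basis_mod scale U W (v ` K)" and "card (v ` K) = card K"
proof -
  have inj: "inj_on v K"
  proof (rule inj_onI, rule ccontr)
    fix k l assume kl: "k \<in> K" "l \<in> K" "v k = v l" "k \<noteq> l"
    \<comment> \<open>If two members coincided, the coefficients 1 and -1 would give a relation with
      value 0, which lies in W.\<close>
    let ?c = "\<lambda>i. if i = k then 1 else if i = l then - 1 else 0"
    have "(\<Sum>i\<in>K. scale (?c i) (v i)) = (\<Sum>i\<in>{k, l}. scale (?c i) (v i))"
      by (rule sum.mono_neutral_right) (use kl fin in auto)
    also have "\<dots> = 0" using kl by simp
    finally show False using indep[of ?c k] kl W by simp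
  qed
  show "card (v ` K) = card K" by (rule card_image[OF inj])
  have "\<exists>c. u - (\<Sum>b\<in>v ` K. scale (c b) b) \<in> W" if "u \<in> U" for u
  proof -
    obtain c where c: "u - (\<Sum>k\<in>K. scale (c k) (v k)) \<in> W" using span[OF \<open>u \<in> U\<close>] by blast
    have "(\<Sum>b\<in>v ` K. scale (c (inv_into K v b)) b) = (\<Sum>k\<in>K. scale (c k) (v k))"
      by (simp add: sum.reindex inj)
    with c show ?thesis by metis
  qed
  moreover have "c b = 0" if "(\<Sum>b\<in>v ` K. scale (c b) b) \<in> W" "b \<in> v ` K" for c b
    using indep[of "c \<circ> v"] that by (auto simp: sum.reindex inj)
  ultimately show "basis_mod scale U W (v ` K)"
    using fin U unfolding basis_mod_def independent_mod_def by blast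
qed

text \<open>\<open>\<phi>\<close> presents \<open>N\<close> as the quotient of \<open>U\<close> by \<open>U \<inter> W\<close>.\<close>

locale subspace_quotient = vector_space scale
  for scale :: "'a::field \<Rightarrow> 'b::ab_group_add \<Rightarrow> 'b" +
  fixes U W :: "'b set" and N :: "('a, 'c) module" and \<phi> :: "'b \<Rightarrow> 'c"
  assumes U_0: "0 \<in> U" and U_add: "\<And>a b. a \<in> U \<Longrightarrow> b \<in> U \<Longrightarrow> a + b \<in> U"
    and U_scale: "\<And>c a. a \<in> U \<Longrightarrow> scale c a \<in> U"
    and W_0: "0 \<in> W" and W_scale: "\<And>c a. a \<in> W \<Longrightarrow> scale c a \<in> W"
    and carrier_eq: "carrier N = \<phi> ` U"
    and zero_eq: "\<zero>\<^bsub>N\<^esub> = \<phi> 0"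
    and add_eq: "\<And>a b. a \<in> U \<Longrightarrow> b \<in> U \<Longrightarrow> \<phi> a \<oplus>\<^bsub>N\<^esub> \<phi> b = \<phi> (a + b)"
    and smult_eq: "\<And>c a. a \<in> U \<Longrightarrow> c \<odot>\<^bsub>N\<^esub> \<phi> a = \<phi> (scale c a)"
    and eq_iff: "\<And>a b. a \<in> U \<Longrightarrow> b \<in> U \<Longrightarrow> \<phi> a = \<phi> b \<longleftrightarrow> a - b \<in> W"
begin

lemma vectorspace: "vectorspace class_ring N"
proof (rule vs_criteria)
  show "field (class_ring :: 'a ring)" by (rule class_field)
  show "\<forall>v\<in>carrier N. \<exists>w\<in>carrier N. v \<oplus>\<^bsub>N\<^esub> w = \<zero>\<^bsub>N\<^esub>"
  proof
    fix v assume "v \<in> carrier N"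
    then obtain u where u: "u \<in> U" "v = \<phi> u" by (auto simp: carrier_eq)
    show "\<exists>w\<in>carrier N. v \<oplus>\<^bsub>N\<^esub> w = \<zero>\<^bsub>N\<^esub>"
      using U_scale[OF u(1), of "- 1"] u by (intro bexI[of _ "\<phi> (- u)"]) (auto simp: carrier_eq zero_eq add_eq)
  qed
qed (auto simp: carrier_eq zero_eq add_eq smult_eq U_0 U_add U_scale add_ac scale_right_distrib scale_left_distrib)

lemma U_sum: "(\<And>i. i \<in> A \<Longrightarrow> f i \<in> U) \<Longrightarrow> sum f A \<in> U"
  by (induction A rule: infinite_finite_induct) (auto intro: U_add U_0)

lemma lincomb_image:
  assumes "finite B" "B \<subseteq> U" "inj_on \<phi> B"
  shows "LinearCombinations.module.lincomb N c (\<phi> ` B) = \<phi> (\<Sum>b\<in>B. scale (c (\<phi> b)) b)"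
proof -
  interpret N: vectorspace class_ring N by (rule vectorspace)
  have *: "(\<Oplus>\<^bsub>N\<^esub>b\<in>B. \<phi> (f b)) = \<phi> (sum f B)" if "finite B" "\<And>b. b \<in> B \<Longrightarrow> f b \<in> U" for f :: "'b \<Rightarrow> 'b" and B
    using that by (induction B) (auto simp: zero_eq add_eq U_sum N.finsum_insert Pi_def carrier_eq)
  have "(\<lambda>v. c v \<odot>\<^bsub>N\<^esub> v) \<in> \<phi> ` B \<rightarrow> carrier N"
    using assms by (auto simp: carrier_eq smult_eq U_scale subset_iff)
  then have "N.lincomb c (\<phi> ` B) = (\<Oplus>\<^bsub>N\<^esub>b\<in>B. c (\<phi> b) \<odot>\<^bsub>N\<^esub> \<phi> b)"
    unfolding N.lincomb_def using assms(3) by (rule N.finsum_reindex)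
  also have "\<dots> = (\<Oplus>\<^bsub>N\<^esub>b\<in>B. \<phi> (scale (c (\<phi> b)) b))"
    by (rule N.finsum_cong') (use assms in \<open>auto simp: carrier_eq smult_eq U_scale subset_iff\<close>)
  also have "\<dots> = \<phi> (\<Sum>b\<in>B. scale (c (\<phi> b)) b)"
    by (rule *) (use assms U_scale in auto)
  finally show ?thesis .
qed

text \<open>Two elements of B with the same image differ by an element of W, a forbidden relation;
  so passing to the quotient keeps the cardinality.\<close>

lemma image_lin_indpt:
  assumes indep: "independent_mod scale W B" and sub: "B \<subseteq> U"
  shows "inj_on \<phi> B" and "\<not> LinearCombinations.module.lin_dep class_ring N (\<phi> ` B)"
proof -
  interpret N: vectorspace class_ring N by (rule vectorspace)
  note B = conjunct1[OF indep[unfolded independent_mod_def]] sub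
  show inj: "inj_on \<phi> B"
  proof (rule inj_onI, rule ccontr)
    fix a b assume ab: "a \<in> B" "b \<in> B" "\<phi> a = \<phi> b" "a \<noteq> b"
    let ?c = "\<lambda>x. if x = a then 1 else if x = b then - 1 else 0"
    have "(\<Sum>x\<in>B. scale (?c x) x) = (\<Sum>x\<in>{a, b}. scale (?c x) x)"
      by (rule sum.mono_neutral_right) (use ab B in auto)
    also have "\<dots> = a - b" using ab by simp
    also have "\<dots> \<in> W" using ab B eq_iff[of a b] by auto
    finally show False using independent_modD[OF indep, of ?c a] ab by simp
  qed
  show "N.lin_indpt (\<phi> ` B)"
  proof (rule N.finite_lin_indpt2)
    fix c assume "N.lincomb c (\<phi> ` B) = \<zero>\<^bsub>N\<^esub>"
    then have "\<phi> (\<Sum>b\<in>B. scale (c (\<phi> b)) b) = \<phi> 0"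
      by (simp add: lincomb_image[OF B inj] zero_eq)
    then have "(\<Sum>b\<in>B. scale (c (\<phi> b)) b) \<in> W"
      using B by (subst (asm) eq_iff) (auto intro!: U_sum U_scale U_0)
    from independent_modD[OF indep this] show "\<forall>v\<in>\<phi> ` B. c v = \<zero>\<^bsub>class_ring\<^esub>" by auto
  qed (use B in \<open>auto simp: carrier_eq\<close>)
qed

lemma card_le_dim:
  assumes "independent_mod scale W B" "B \<subseteq> U" "vectorspace.fin_dim class_ring N"
  shows "card B \<le> vectorspace.dim class_ring N"
proof -
  interpret N: vectorspace class_ring N by (rule vectorspace)
  have "card (\<phi> ` B) \<le> N.dim"
    by (rule N.li_le_dim(2)) (use assms image_lin_indpt(2) in \<open>auto simp: carrier_eq\<close>)
  then show ?thesis using image_lin_indpt(1) assms by (simp add: card_image)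
qed

lemma dim_eq_card:
  assumes "basis_mod scale U W B"
  shows "vectorspace.dim class_ring N = card B"
proof -
  interpret N: vectorspace class_ring N by (rule vectorspace)
  have indep: "independent_mod scale W B" and B: "finite B" "B \<subseteq> U"
    and span: "\<And>u. u \<in> U \<Longrightarrow> \<exists>c. u - (\<Sum>b\<in>B. scale (c b) b) \<in> W"
    using assms unfolding basis_mod_def independent_mod_def by blast+
  note inj = image_lin_indpt(1)[OF indep B(2)] and li = image_lin_indpt(2)[OF indep B(2)]
  have sub: "\<phi> ` B \<subseteq> carrier N" using B by (auto simp: carrier_eq)
  have "carrier N \<subseteq> N.span (\<phi> ` B)"
  proof
    fix x assume "x \<in> carrier N"
    then obtain u where u: "u \<in> U" "x = \<phi> u" by (auto simp: carrier_eq)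
    then obtain c where c: "u - (\<Sum>b\<in>B. scale (c b) b) \<in> W" using span by blast
    let ?c = "\<lambda>v. c (inv_into B \<phi> v)"
    have "N.lincomb ?c (\<phi> ` B) = \<phi> (\<Sum>b\<in>B. scale (c b) b)"
      unfolding lincomb_image[OF B(1,2) inj] by (simp add: inj cong: sum.cong)
    also have "\<dots> = x"
      unfolding u(2) using c u(1) B by (subst eq_commute, subst eq_iff) (auto intro!: U_sum U_scale)
    finally show "x \<in> N.span (\<phi> ` B)"
      unfolding N.finite_span[OF finite_imageI[OF B(1)] sub] by auto
  qed
  then have "N.basis (\<phi> ` B)"
    unfolding N.basis_def using li sub N.span_is_subset2[OF sub] by auto
  then have "N.dim = card (\<phi> ` B)"
    using B(1) by (intro N.dim_basis) auto
  then show ?thesis by (simp add: card_image inj)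
qed

text \<open>Finite dimension enters here: it bounds the size of independent subsets of K, so one of
  largest size exists. An element of K outside its span modulo W could be added to it.\<close>

lemma basis_mod_exists:
  assumes fd: "vectorspace.fin_dim class_ring N" and "K \<subseteq> U"
  shows "\<exists>B. basis_mod scale K W B"
proof -
  let ?P = "\<lambda>B. independent_mod scale W B \<and> B \<subseteq> K"
  have "\<exists>B. ?P B \<and> (\<forall>C. ?P C \<longrightarrow> card C \<le> card B)"
  proof (rule Lattices_Big.ex_has_greatest_nat)
    show "?P {}" by (simp add: independent_mod_def)
    show "\<forall>B. ?P B \<longrightarrow> card B < Suc (vectorspace.dim class_ring N)"
      using card_le_dim[OF _ _ fd] assms(2) by (auto simp: less_Suc_eq_le)
  qed
  then obtain B where indep: "independent_mod scale W B" and B: "finite B" "B \<subseteq> K"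
    and max: "\<And>C. ?P C \<Longrightarrow> card C \<le> card B" unfolding independent_mod_def by blast
  have "\<exists>c. u - (\<Sum>b\<in>B. scale (c b) b) \<in> W" if u: "u \<in> K" for u
  proof (rule ccontr)
    assume no: "\<nexists>c. u - (\<Sum>b\<in>B. scale (c b) b) \<in> W"
    have "u \<notin> B"
    proof
      assume "u \<in> B"
      then have "(\<Sum>b\<in>B. scale (if b = u then 1 else 0) b) = (\<Sum>b\<in>{u}. scale (if b = u then 1 else 0) b)"
        by (intro sum.mono_neutral_right) (use B in auto)
      then have "u - (\<Sum>b\<in>B. scale (if b = u then 1 else 0) b) \<in> W" by (simp add: W_0)
      then have "\<exists>c. u - (\<Sum>b\<in>B. scale (c b) b) \<in> W"
        by (rule exI[of _ "\<lambda>b. if b = u then 1 else 0"])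
      with no show False by contradiction
    qed
    have "?P (insert u B)"
      unfolding independent_mod_def
    proof (intro conjI allI impI ballI)
      fix d b assume d: "(\<Sum>b\<in>insert u B. scale (d b) b) \<in> W" and b: "b \<in> insert u B"
      have d': "scale (d u) u + (\<Sum>b\<in>B. scale (d b) b) \<in> W"
        using d \<open>u \<notin> B\<close> B by simp
      have "d u = 0"
      proof (rule ccontr)
        assume "d u \<noteq> 0"
        \<comment> \<open>Dividing a relation by a nonzero coefficient of u would express u modulo W
          through B.\<close>
        have "scale (inverse (d u)) (scale (d u) u + (\<Sum>b\<in>B. scale (d b) b)) =
          u - (\<Sum>b\<in>B. scale (- (inverse (d u) * d b)) b)"
          using \<open>d u \<noteq> 0\<close> by (simp add: scale_right_distrib scale_sum_right sum_negf)
        then have "u - (\<Sum>b\<in>B. scale (- (inverse (d u) * d b)) b) \<in> W"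
          using W_scale[OF d', of "inverse (d u)"] by (simp only:)
        then have "\<exists>c. u - (\<Sum>b\<in>B. scale (c b) b) \<in> W"
          by (rule exI[of _ "\<lambda>b. - (inverse (d u) * d b)"])
        with no show False by contradiction
      qed
      with d' independent_modD[OF indep, of d] b show "d b = 0" by auto
    qed (use B u in auto)
    from max[OF this] show False using \<open>u \<notin> B\<close> B by simp
  qed
  then show ?thesis using B indep unfolding basis_mod_def by blast
qed

end

section \<open>The lower central series of a quotient of the free algebra\<close>

interpretation ncpoly: vector_space scale_ncpoly
  by standard (auto intro!: poly_mapping_eqI simp: lookup_add algebra_simps)

lemma in_carrier_free_algebra_iff: 
  "a \<in> carrier (free_algebra n) \<longleftrightarrow> (\<forall>w \<in> Poly_Mapping.keys a. set (letters w) \<subseteq> {1..n})"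
  by (simp add: free_algebra_def)

lemma free_algebra_simps [simp]:
  "a \<otimes>\<^bsub>free_algebra n\<^esub> b = a * b" "a \<oplus>\<^bsub>free_algebra n\<^esub> b = a + b"
  "\<zero>\<^bsub>free_algebra n\<^esub> = 0" "\<one>\<^bsub>free_algebra n\<^esub> = 1" "c \<odot>\<^bsub>free_algebra n\<^esub> a = scale_ncpoly c a"
  by (simp_all add: free_algebra_def)

lemma carrier_free_algebra_closed:
  fixes a b :: "'k::field ncpoly"
  shows "(0 :: 'k ncpoly) \<in> carrier (free_algebra n)" "(1 :: 'k ncpoly) \<in> carrier (free_algebra n)"
  "a \<in> carrier (free_algebra n) \<Longrightarrow> b \<in> carrier (free_algebra n) \<Longrightarrow> a + b \<in> carrier (free_algebra n)"
  "a \<in> carrier (free_algebra n) \<Longrightarrow> b \<in> carrier (free_algebra n) \<Longrightarrow> a * b \<in> carrier (free_algebra n)"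
  "a \<in> carrier (free_algebra n) \<Longrightarrow> - a \<in> carrier (free_algebra n)"
  "a \<in> carrier (free_algebra n) \<Longrightarrow> scale_ncpoly c a \<in> carrier (free_algebra n)"
proof -
  interpret F: ring "free_algebra n :: ('k, 'k ncpoly) module" by (rule free_algebra_ring)
  show "(0 :: 'k ncpoly) \<in> carrier (free_algebra n)" "(1 :: 'k ncpoly) \<in> carrier (free_algebra n)"
    using F.zero_closed F.one_closed by simp_all
  show "a \<in> carrier (free_algebra n) \<Longrightarrow> b \<in> carrier (free_algebra n) \<Longrightarrow> a + b \<in> carrier (free_algebra n)"
    using F.a_closed by simp
  show "a \<in> carrier (free_algebra n) \<Longrightarrow> b \<in> carrier (free_algebra n) \<Longrightarrow> a * b \<in> carrier (free_algebra n)"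
    using F.m_closed by simp
  show "a \<in> carrier (free_algebra n) \<Longrightarrow> - a \<in> carrier (free_algebra n)"
    by (simp add: in_carrier_free_algebra_iff)
  show "a \<in> carrier (free_algebra n) \<Longrightarrow> scale_ncpoly c a \<in> carrier (free_algebra n)"
    by (auto simp: in_carrier_free_algebra_iff in_keys_iff)
qed

lemma carrier_free_algebra_diff:
  "a \<in> carrier (free_algebra n) \<Longrightarrow> b \<in> carrier (free_algebra n) \<Longrightarrow> a - b \<in> carrier (free_algebra n)"
  using carrier_free_algebra_closed(3)[of a n "- b"] carrier_free_algebra_closed(5)[of b n] by simp

lemma free_algebra_minus [simp]:
  assumes "a \<in> carrier (free_algebra n)" "b \<in> carrier (free_algebra n)"
  shows "a \<ominus>\<^bsub>free_algebra n\<^esub> b = a - (b :: 'k::field ncpoly)"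
proof -
  interpret F: ring "free_algebra n :: ('k, 'k ncpoly) module" by (rule free_algebra_ring)
  have "\<ominus>\<^bsub>free_algebra n\<^esub> b = - b"
    using assms(2) by (intro F.minus_equality) (simp_all add: carrier_free_algebra_closed)
  then show ?thesis by (simp add: a_minus_def)
qed

lemma free_component_subset: "free_component n r d \<subseteq> carrier (free_algebra n)"
  by (auto simp: free_component_def)

lemma hasse_carrier: "a \<in> carrier (free_algebra n) \<Longrightarrow> hasse s j a \<in> carrier (free_algebra n)"
  using hasse_free_component[of a n 0 0 s j] by (simp add: free_component_def)

text \<open>\<open>smult\<close> of \<^const>\<open>quotient_algebra\<close> is a union over a coset; on cosets of a submodule all members agree.\<close>

lemma smult_coset:
  assumes "Module.module class_ring A" "ring A" "ideal K A"
    and K: "\<And>x. x \<in> K \<Longrightarrow> c \<odot>\<^bsub>A\<^esub> x \<in> K" and x: "x \<in> carrier A"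
  shows "(\<Union>y\<in>K +>\<^bsub>A\<^esub> x. K +>\<^bsub>A\<^esub> (c \<odot>\<^bsub>A\<^esub> y)) = K +>\<^bsub>A\<^esub> (c \<odot>\<^bsub>A\<^esub> x)"
proof -
  interpret A: Module.module class_ring A by fact
  interpret R: ring A by fact
  interpret K: ideal K A by fact
  have "K +>\<^bsub>A\<^esub> (c \<odot>\<^bsub>A\<^esub> y) = K +>\<^bsub>A\<^esub> (c \<odot>\<^bsub>A\<^esub> x)" if "y \<in> K +>\<^bsub>A\<^esub> x" for y
  proof -
    from that obtain h where h: "h \<in> K" "y = h \<oplus>\<^bsub>A\<^esub> x" by (auto simp: a_r_coset_def')
    have hc: "h \<in> carrier A" using h(1) K.a_subset by auto
    then have "c \<odot>\<^bsub>A\<^esub> y = c \<odot>\<^bsub>A\<^esub> h \<oplus>\<^bsub>A\<^esub> c \<odot>\<^bsub>A\<^esub> x"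
      using h x by (simp add: A.smult_r_distr)
    then have "c \<odot>\<^bsub>A\<^esub> y \<in> K +>\<^bsub>A\<^esub> (c \<odot>\<^bsub>A\<^esub> x)"
      using K[OF h(1)] by (auto simp: a_r_coset_def')
    then show ?thesis
      using x by (intro abelian_group.a_repr_independence[OF R.is_abelian_group, symmetric])
        (auto intro: K.a_subgroup)
  qed
  moreover have "x \<in> K +>\<^bsub>A\<^esub> x"
    using x K.zero_closed by (force simp: a_r_coset_def')
  ultimately show ?thesis by blast
qed

locale free_quotient =
  fixes n :: nat and I :: "'k::field ncpoly set" and A :: "('k, 'k ncpoly set) module"
  assumes ideal_I: "ideal I (free_algebra n :: ('k, 'k ncpoly) module)"
    and A_eq: "A = quotient_algebra (free_algebra n) I"
begin

abbreviation F :: "('k, 'k ncpoly) module" where "F \<equiv> free_algebra n"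

abbreviation \<pi> :: "'k ncpoly \<Rightarrow> 'k ncpoly set" where "\<pi> a \<equiv> I +>\<^bsub>F\<^esub> a"

sublocale F: ring F by (rule free_algebra_ring)
sublocale I: ideal I F by (rule ideal_I)

lemma I_subset: "a \<in> I \<Longrightarrow> a \<in> carrier F"
  using I.a_subset by auto

lemma I_closed: "0 \<in> I" "a \<in> I \<Longrightarrow> b \<in> I \<Longrightarrow> a + b \<in> I"
  "a \<in> I \<Longrightarrow> b \<in> carrier F \<Longrightarrow> a * b \<in> I" "a \<in> I \<Longrightarrow> b \<in> carrier F \<Longrightarrow> b * a \<in> I"
  using I.zero_closed I.a_closed[of a b] I.I_r_closed[of a b] I.I_l_closed[of a b] by simp_all

lemma I_scale: "a \<in> I \<Longrightarrow> scale_ncpoly c a \<in> I"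
  unfolding scale_ncpoly_conv_mult
  by (rule I_closed) (auto simp: in_carrier_free_algebra_iff zero_ncmonom_def split: if_splits)

lemma \<pi>_eq_iff: "a \<in> carrier F \<Longrightarrow> b \<in> carrier F \<Longrightarrow> \<pi> a = \<pi> b \<longleftrightarrow> a - b \<in> I"
  using F.quotient_eq_iff_same_a_r_cos[OF ideal_I, of a b] by simp

lemma A_carrier: "carrier A = \<pi> ` carrier F"
  by (auto simp: A_eq quotient_algebra_simps FactRing_def A_RCOSETS_def')

lemma A_mult: "a \<in> carrier F \<Longrightarrow> b \<in> carrier F \<Longrightarrow> \<pi> a \<otimes>\<^bsub>A\<^esub> \<pi> b = \<pi> (a * b)"
  using I.rcoset_mult_add[of a b] by (simp add: A_eq quotient_algebra_simps FactRing_def)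

lemma A_add: "a \<in> carrier F \<Longrightarrow> b \<in> carrier F \<Longrightarrow> \<pi> a \<oplus>\<^bsub>A\<^esub> \<pi> b = \<pi> (a + b)"
  using I.a_rcos_sum[of a b] by (simp add: A_eq quotient_algebra_simps FactRing_def)

lemma A_zero: "\<zero>\<^bsub>A\<^esub> = \<pi> 0"
  using F.a_rcos_zero[OF ideal_I I_closed(1)] by (simp add: A_eq quotient_algebra_simps FactRing_def)

lemma A_one: "\<one>\<^bsub>A\<^esub> = \<pi> 1"
  by (simp add: A_eq quotient_algebra_simps FactRing_def)

lemma A_smult: "a \<in> carrier F \<Longrightarrow> c \<odot>\<^bsub>A\<^esub> \<pi> a = \<pi> (scale_ncpoly c a)"
  using smult_coset[OF free_algebra_module free_algebra_ring ideal_I, of c a] I_scale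
  by (simp add: A_eq quotient_algebra_simps)

lemma A_module: "Module.module class_ring A"
proof -
  \<comment> \<open>The vector space axioms for A come from the same presentation that later counts
    dimensions, here with the whole free algebra modulo I.\<close>
  interpret Q: subspace_quotient scale_ncpoly "carrier F" I A \<pi>
    by unfold_locales
      (auto simp: carrier_free_algebra_closed I_closed I_scale A_carrier A_zero A_add A_smult \<pi>_eq_iff)
  show ?thesis using Q.vectorspace by (simp add: vectorspace_def)
qed

sublocale A: Module.module class_ring A by (rule A_module)

lemma A_ring: "ring A"
proof (rule ringI)
  show "abelian_group A" by unfold_locales
  show "Group.monoid A"
    by (rule monoidI) (auto simp: A_carrier A_mult A_one carrier_free_algebra_closed mult.assoc)
qed (auto simp: A_carrier A_mult A_add carrier_free_algebra_closed algebra_simps)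

sublocale A: ring A by (rule A_ring)

lemma A_minus: "a \<in> carrier F \<Longrightarrow> b \<in> carrier F \<Longrightarrow> \<pi> a \<ominus>\<^bsub>A\<^esub> \<pi> b = \<pi> (a - b)"
proof -
  assume ab: "a \<in> carrier F" "b \<in> carrier F"
  have "\<ominus>\<^bsub>A\<^esub> \<pi> b = \<pi> (- b)"
    using ab by (intro A.minus_equality) (auto simp: A_carrier A_add A_zero carrier_free_algebra_closed)
  then show ?thesis using ab by (simp add: a_minus_def A_add carrier_free_algebra_closed)
qed

lemma lower_central_submodule: "submodule class_ring (lower_central A i) A"
proof (induction i rule: less_induct)
  case (less i)
  have carrier: "submodule class_ring (carrier A) A"
    by (auto intro!: submodule.intro A_module)
  consider "i = 0" | "i = Suc 0" | j where "i = Suc (Suc j)" by (metis not0_implies_Suc)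
  then show ?case
  proof cases
    case 3
    interpret L: submodule class_ring "lower_central A (Suc j)" A using less 3 by simp
    show ?thesis unfolding 3 lower_central.simps
      by (rule A.span_is_submodule) (use L.subset in auto)
  qed (use carrier in simp_all)
qed

lemma lower_central_subset: "lower_central A i \<subseteq> carrier A"
  using lower_central_submodule by (simp add: submodule_def)

text \<open>Preimages in the free algebra of L_i(A), and below of M_i(A). Hasse derivatives act on
  the free algebra, so stability of these preimages replaces operators on A; both contain I.\<close>

definition lcs :: "nat \<Rightarrow> 'k ncpoly set"
  where "lcs i = {a \<in> carrier F. \<pi> a \<in> lower_central A i}"

definition lcs_ideal :: "nat \<Rightarrow> 'k ncpoly set"
  where "lcs_ideal i = {a \<in> carrier F. \<pi> a \<in> lower_central_ideal A i}"

lemma lcs_carrier: "a \<in> lcs i \<Longrightarrow> a \<in> carrier F"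
  and lcs_ideal_carrier: "a \<in> lcs_ideal i \<Longrightarrow> a \<in> carrier F"
  by (simp_all add: lcs_def lcs_ideal_def)

lemma lcs_closed:
  "0 \<in> lcs i" "a \<in> lcs i \<Longrightarrow> b \<in> lcs i \<Longrightarrow> a + b \<in> lcs i" "a \<in> lcs i \<Longrightarrow> scale_ncpoly c a \<in> lcs i"
proof -
  interpret L: submodule class_ring "lower_central A i" A by (rule lower_central_submodule)
  show "0 \<in> lcs i" using L.zero_closed by (simp add: lcs_def A_zero carrier_free_algebra_closed)
  show "a + b \<in> lcs i" if "a \<in> lcs i" "b \<in> lcs i"
    using that L.m_closed[of "\<pi> a" "\<pi> b"] by (simp add: lcs_def A_add carrier_free_algebra_closed)
  show "scale_ncpoly c a \<in> lcs i" if "a \<in> lcs i"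
    using that L.smult_closed[of c "\<pi> a"] by (simp add: lcs_def A_smult carrier_free_algebra_closed)
qed

lemma lcs_sum: "(\<And>x. x \<in> X \<Longrightarrow> f x \<in> lcs i) \<Longrightarrow> sum f X \<in> lcs i"
  by (induction X rule: infinite_finite_induct) (auto intro: lcs_closed)

lemma I_subset_lcs: "a \<in> I \<Longrightarrow> a \<in> lcs i"
  using \<pi>_eq_iff[of a 0] lcs_closed(1)[of i] I_subset[of a] by (simp add: lcs_def carrier_free_algebra_closed)

lemma lcs_commutator:
  assumes "x \<in> carrier F" "l \<in> lcs (Suc i)"
  shows "x * l - l * x \<in> lcs (Suc (Suc i))"
proof -
  let ?S = "{(a \<otimes>\<^bsub>A\<^esub> l) \<ominus>\<^bsub>A\<^esub> (l \<otimes>\<^bsub>A\<^esub> a) | a l. a \<in> carrier A \<and> l \<in> lower_central A (Suc i)}"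
  have "\<pi> x \<otimes>\<^bsub>A\<^esub> \<pi> l \<ominus>\<^bsub>A\<^esub> \<pi> l \<otimes>\<^bsub>A\<^esub> \<pi> x \<in> ?S"
    using assms by (auto simp: lcs_def A_carrier)
  moreover have "?S \<subseteq> A.span ?S"
    by (rule A.in_own_span) (use lower_central_subset[of "Suc i"] in auto)
  ultimately have "\<pi> x \<otimes>\<^bsub>A\<^esub> \<pi> l \<ominus>\<^bsub>A\<^esub> \<pi> l \<otimes>\<^bsub>A\<^esub> \<pi> x \<in> lower_central A (Suc (Suc i))"
    by auto
  then show ?thesis
    using assms by (simp add: lcs_def A_mult A_minus carrier_free_algebra_closed carrier_free_algebra_diff)
qed

text \<open>The classes having some representative with Q form a submodule containing all
  commutators, hence all of L_{i+2}(A). This yields Q for some element of the class of a, and the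
  case \<open>ideal\<close> together with \<open>add\<close> moves it to a itself.\<close>

lemma lcs_induct [consumes 1, case_names ideal commutator add scale]:
  assumes "a \<in> lcs (Suc (Suc i))"
    and QI: "\<And>b. b \<in> I \<Longrightarrow> Q b"
    and Qcomm: "\<And>x l. x \<in> carrier F \<Longrightarrow> l \<in> lcs (Suc i) \<Longrightarrow> Q (x * l - l * x)"
    and Qadd: "\<And>b c. Q b \<Longrightarrow> Q c \<Longrightarrow> Q (b + c)"
    and Qscale: "\<And>c b. Q b \<Longrightarrow> Q (scale_ncpoly c b)"
  shows "Q a"
proof -
  define H where "H = {\<pi> b | b. b \<in> carrier F \<and> Q b}"
  have "submodule class_ring H A"
  proof (rule submodule.intro)
    show "\<zero>\<^bsub>A\<^esub> \<in> H"
      unfolding H_def A_zero using QI[OF I_closed(1)] carrier_free_algebra_closed(1) by blast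
    show "v \<oplus>\<^bsub>A\<^esub> w \<in> H" if "v \<in> H" "w \<in> H" for v w
    proof -
      from that obtain b c where "v = \<pi> b" "b \<in> carrier F" "Q b" "w = \<pi> c" "c \<in> carrier F" "Q c"
        by (auto simp: H_def)
      then have "v \<oplus>\<^bsub>A\<^esub> w = \<pi> (b + c)" "b + c \<in> carrier F" "Q (b + c)"
        by (simp_all add: A_add carrier_free_algebra_closed Qadd)
      then show ?thesis unfolding H_def by blast
    qed
    show "c \<odot>\<^bsub>A\<^esub> v \<in> H" if "v \<in> H" for c v
    proof -
      from that obtain b where "v = \<pi> b" "b \<in> carrier F" "Q b"
        by (auto simp: H_def)
      then have "c \<odot>\<^bsub>A\<^esub> v = \<pi> (scale_ncpoly c b)" "scale_ncpoly c b \<in> carrier F" "Q (scale_ncpoly c b)"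
        by (simp_all add: A_smult carrier_free_algebra_closed Qscale)
      then show ?thesis unfolding H_def by blast
    qed
  qed (auto simp: H_def A_carrier A_module)
  moreover have "{(a \<otimes>\<^bsub>A\<^esub> l) \<ominus>\<^bsub>A\<^esub> (l \<otimes>\<^bsub>A\<^esub> a) | a l. a \<in> carrier A \<and> l \<in> lower_central A (Suc i)} \<subseteq> H"
  proof clarify
    fix X L assume X: "X \<in> carrier A" and L: "L \<in> lower_central A (Suc i)"
    then obtain x l where x: "x \<in> carrier F" "X = \<pi> x" and l: "l \<in> carrier F" "L = \<pi> l"
      using lower_central_subset[of "Suc i"] by (auto simp: A_carrier)
    have "Q (x * l - l * x)" using x l L by (intro Qcomm) (auto simp: lcs_def)
    moreover have "X \<otimes>\<^bsub>A\<^esub> L \<ominus>\<^bsub>A\<^esub> L \<otimes>\<^bsub>A\<^esub> X = \<pi> (x * l - l * x)"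
      using x l by (simp add: A_mult A_minus carrier_free_algebra_closed)
    moreover have "x * l - l * x \<in> carrier F"
      using x l by (simp add: carrier_free_algebra_closed carrier_free_algebra_diff)
    ultimately show "X \<otimes>\<^bsub>A\<^esub> L \<ominus>\<^bsub>A\<^esub> L \<otimes>\<^bsub>A\<^esub> X \<in> H" unfolding H_def by blast
  qed
  ultimately have "lower_central A (Suc (Suc i)) \<subseteq> H"
    unfolding lower_central.simps by (intro A.span_is_subset)
  then obtain b where b: "\<pi> a = \<pi> b" "b \<in> carrier F" "Q b"
    using assms(1) by (auto simp: lcs_def H_def)
  then have "a - b \<in> I" using \<pi>_eq_iff[of a b] lcs_carrier[OF assms(1)] by simp
  then have "Q ((a - b) + b)" by (intro Qadd QI b)
  then show ?thesis by simp
qed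

lemma lower_central_ideal_ideal: "ideal (lower_central_ideal A i) A"
  unfolding lower_central_ideal_def by (rule A.genideal_ideal[OF lower_central_subset])

lemma lcs_ideal_closed:
  "0 \<in> lcs_ideal i" "a \<in> lcs_ideal i \<Longrightarrow> b \<in> lcs_ideal i \<Longrightarrow> a + b \<in> lcs_ideal i"
  "x \<in> carrier F \<Longrightarrow> a \<in> lcs_ideal i \<Longrightarrow> x * a \<in> lcs_ideal i"
  "x \<in> carrier F \<Longrightarrow> a \<in> lcs_ideal i \<Longrightarrow> a * x \<in> lcs_ideal i"
proof -
  interpret M: ideal "lower_central_ideal A i" A by (rule lower_central_ideal_ideal)
  show "0 \<in> lcs_ideal i" using M.zero_closed by (simp add: lcs_ideal_def A_zero carrier_free_algebra_closed)
  show "a + b \<in> lcs_ideal i" if "a \<in> lcs_ideal i" "b \<in> lcs_ideal i"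
    using that M.a_closed[of "\<pi> a" "\<pi> b"] by (simp add: lcs_ideal_def A_add carrier_free_algebra_closed)
  show "x * a \<in> lcs_ideal i" "a * x \<in> lcs_ideal i" if "x \<in> carrier F" "a \<in> lcs_ideal i"
    using that M.I_l_closed[of "\<pi> a" "\<pi> x"] M.I_r_closed[of "\<pi> a" "\<pi> x"]
    by (auto simp: lcs_ideal_def A_mult carrier_free_algebra_closed A_carrier)
qed

lemma lcs_ideal_scale: "a \<in> lcs_ideal i \<Longrightarrow> scale_ncpoly c a \<in> lcs_ideal i"
  unfolding scale_ncpoly_conv_mult
  by (rule lcs_ideal_closed) (auto simp: in_carrier_free_algebra_iff zero_ncmonom_def split: if_splits)

lemma lcs_ideal_uminus: "a \<in> lcs_ideal i \<Longrightarrow> - a \<in> lcs_ideal i"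
  using lcs_ideal_scale[of a i "- 1"] by simp

lemma lcs_ideal_sum: "(\<And>x. x \<in> X \<Longrightarrow> f x \<in> lcs_ideal i) \<Longrightarrow> sum f X \<in> lcs_ideal i"
  by (induction X rule: infinite_finite_induct) (auto intro: lcs_ideal_closed)

lemma lcs_subset_lcs_ideal: "a \<in> lcs i \<Longrightarrow> a \<in> lcs_ideal i"
  using A.genideal_self[OF lower_central_subset[of i]]
  by (auto simp: lcs_def lcs_ideal_def lower_central_ideal_def)

text \<open>As for \<open>lcs_induct\<close>, with the generated ideal in place of the span. The
  final change of representative uses that I lies in every \<open>lcs i\<close>.\<close>

lemma lcs_ideal_induct [consumes 1, case_names lcs add mult_left mult_right]:
  assumes "a \<in> lcs_ideal i"
    and Qlcs: "\<And>b. b \<in> lcs i \<Longrightarrow> Q b"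
    and Qadd: "\<And>b c. Q b \<Longrightarrow> Q c \<Longrightarrow> Q (b + c)"
    and Ql: "\<And>x b. x \<in> carrier F \<Longrightarrow> b \<in> carrier F \<Longrightarrow> Q b \<Longrightarrow> Q (x * b)"
    and Qr: "\<And>x b. x \<in> carrier F \<Longrightarrow> b \<in> carrier F \<Longrightarrow> Q b \<Longrightarrow> Q (b * x)"
  shows "Q a"
proof -
  define H where "H = {\<pi> b | b. b \<in> carrier F \<and> Q b}"
  have H: "\<pi> b \<in> H" if "b \<in> carrier F" "Q b" for b
    using that unfolding H_def by blast
  have "ideal H A"
  proof (rule idealI[OF A_ring])
    show "subgroup H (add_monoid A)"
    proof (rule A.add.subgroupI)
      show "H \<subseteq> carrier A" by (auto simp: H_def A_carrier)
      show "H \<noteq> {}" using H[OF carrier_free_algebra_closed(1) Qlcs[OF lcs_closed(1)]] by blast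
      fix v w assume "v \<in> H" "w \<in> H"
      then obtain b c where bc: "v = \<pi> b" "b \<in> carrier F" "Q b" "w = \<pi> c" "c \<in> carrier F" "Q c"
        by (auto simp: H_def)
      show "v \<oplus>\<^bsub>A\<^esub> w \<in> H"
        using bc H[of "b + c"] by (simp add: A_add carrier_free_algebra_closed Qadd)
      have "\<ominus>\<^bsub>A\<^esub> v = \<pi> (- b)"
        using bc by (intro A.minus_equality) (auto simp: A_carrier A_add A_zero carrier_free_algebra_closed)
      \<comment> \<open>Negation is left multiplication by the constant -1, so
        \<open>mult_left\<close> covers it.\<close>
      moreover have "Q (- 1 * b)"
        using bc by (intro Ql) (simp_all add: carrier_free_algebra_closed)
      ultimately show "\<ominus>\<^bsub>A\<^esub> v \<in> H"
        using bc H[of "- b"] by (simp add: carrier_free_algebra_closed)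
    qed
    fix v x assume "v \<in> H" "x \<in> carrier A"
    then obtain b c where bc: "v = \<pi> b" "b \<in> carrier F" "Q b" "x = \<pi> c" "c \<in> carrier F"
      by (auto simp: H_def A_carrier)
    show "x \<otimes>\<^bsub>A\<^esub> v \<in> H" "v \<otimes>\<^bsub>A\<^esub> x \<in> H"
      using bc H[of "c * b"] H[of "b * c"] by (simp_all add: A_mult carrier_free_algebra_closed Ql Qr)
  qed
  moreover have "lower_central A i \<subseteq> H"
    using lower_central_subset[of i] Qlcs by (auto simp: A_carrier lcs_def intro!: H)
  ultimately have "lower_central_ideal A i \<subseteq> H"
    unfolding lower_central_ideal_def by (rule A.genideal_minimal)
  then obtain b where b: "\<pi> a = \<pi> b" "b \<in> carrier F" "Q b"
    using assms(1) by (auto simp: lcs_ideal_def H_def)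
  then have "a - b \<in> I" using \<pi>_eq_iff[of a b] lcs_ideal_carrier[OF assms(1)] by simp
  then have "Q ((a - b) + b)" by (intro Qadd Qlcs I_subset_lcs b)
  then show ?thesis by simp
qed

section \<open>Hasse derivatives and the lower central series\<close>

text \<open>Reversing the second sum pairs f i with g (j - i), so the two Leibniz expansions of a
  commutator combine into a sum of commutators.\<close>

lemma commutator_sum_flip:
  "(\<Sum>i\<le>j. f i * g (j - i)) - (\<Sum>i\<le>j. g i * f (j - i)) = (\<Sum>i\<le>j. f i * g (j - i) - g (j - i) * f i)"
  for f g :: "nat \<Rightarrow> 'k ncpoly"
proof -
  have "(\<Sum>i\<le>j. g i * f (j - i)) = (\<Sum>i\<le>j. g (j - i) * f i)"
    by (rule sum.reindex_bij_witness[of _ "\<lambda>i. j - i" "\<lambda>i. j - i"]) auto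
  then show ?thesis by (simp add: sum_subtractf)
qed

text \<open>D^(j) [x, l] is the sum of the [D^(i) x, D^(j-i) l], and D^(j-i) l is one step lower in
  the series. All orders below q are treated together because the Leibniz rule for one order
  involves every smaller one.\<close>

lemma hasse_lcs:
  assumes I: "\<And>a j. a \<in> I \<Longrightarrow> j < q \<Longrightarrow> hasse s j a \<in> I"
  shows "a \<in> lcs i \<Longrightarrow> j < q \<Longrightarrow> hasse s j a \<in> lcs i"
proof (induction i arbitrary: a j rule: less_induct)
  case (less i)
  consider "i \<le> 1" | k where "i = Suc (Suc k)"
    by (metis One_nat_def Suc_le_mono bot_nat_0.extremum not0_implies_Suc)
  then show ?case
  proof cases
    case 1
    then have "lcs i = carrier F"
      by (cases i) (auto simp: lcs_def A_carrier)
    then show ?thesis using less.prems by (simp add: hasse_carrier)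
  next
    case (2 k)
    have "\<forall>j<q. hasse s j a \<in> lcs (Suc (Suc k))"
      using less.prems(1)[unfolded 2]
    proof (induction rule: lcs_induct)
      case (commutator x l)
      show ?case
      proof (intro allI impI)
        fix j assume "j < q"
        then have "hasse s i x * hasse s (j - i) l - hasse s (j - i) l * hasse s i x \<in> lcs (Suc (Suc k))" for i
          using commutator less.IH[of "Suc k"] by (intro lcs_commutator hasse_carrier) (auto simp: 2)
        then show "hasse s j (x * l - l * x) \<in> lcs (Suc (Suc k))"
          unfolding hasse_diff hasse_mult
            commutator_sum_flip[of "\<lambda>i. hasse s i x" "\<lambda>i. hasse s i l"] by (intro lcs_sum)
      qed
    qed (auto simp: hasse_add hasse_scale intro: lcs_closed I_subset_lcs I)
    then show ?thesis using less.prems(2) 2 by simp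
  qed
qed

lemma hasse_lcs_ideal:
  assumes I: "\<And>a j. a \<in> I \<Longrightarrow> j < q \<Longrightarrow> hasse s j a \<in> I"
    and "a \<in> lcs_ideal i" "j < q"
  shows "hasse s j a \<in> lcs_ideal i"
proof -
  have "\<forall>j<q. hasse s j a \<in> lcs_ideal i"
    using assms(2)
  proof (induction rule: lcs_ideal_induct)
    case (lcs b)
    then show ?case using hasse_lcs[OF I] lcs_subset_lcs_ideal by blast
  next
    case (mult_left x b)
    then show ?case by (auto simp: hasse_mult intro!: lcs_ideal_closed(3) lcs_ideal_sum hasse_carrier)
  next
    case (mult_right x b)
    then show ?case by (auto simp: hasse_mult intro!: lcs_ideal_closed(4) lcs_ideal_sum hasse_carrier)
  qed (auto simp: hasse_add intro: lcs_ideal_closed)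
  then show ?thesis using assms(3) by blast
qed

text \<open>The link between the graded piece of N_i(A) and representatives: U is the part of the
  preimage of M_i(A) in degree d, and W the preimage of M_{i+1}(A).\<close>

lemma lower_central_component_quotient:
  assumes N: "N = lower_central_component A i (\<pi> ` free_component n r d)"
  shows "subspace_quotient scale_ncpoly (lcs_ideal i \<inter> free_component n r d) (lcs_ideal (Suc i))
    N (\<lambda>a. lower_central_ideal A (Suc i) +>\<^bsub>A\<^esub> \<pi> a)"
proof -
  let ?M = "lower_central_ideal A (Suc i)"
  interpret M: ideal ?M A by (rule lower_central_ideal_ideal)
  have N_simps: "carrier N = (\<lambda>x. ?M +>\<^bsub>A\<^esub> x) ` (lower_central_ideal A i \<inter> \<pi> ` free_component n r d)"
    "\<zero>\<^bsub>N\<^esub> = ?M" "X \<oplus>\<^bsub>N\<^esub> Y = X <+>\<^bsub>A\<^esub> Y" "c \<odot>\<^bsub>N\<^esub> X = (\<Union>x\<in>X. ?M +>\<^bsub>A\<^esub> (c \<odot>\<^bsub>A\<^esub> x))" for X Y c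
    by (simp_all add: N lower_central_component_def lower_central_quotient_def quotient_algebra_simps
        FactRing_def set_add_def' a_r_coset_def')
  have M_scale: "c \<odot>\<^bsub>A\<^esub> x \<in> ?M" if "x \<in> ?M" for c x
  proof -
    from that obtain a where "a \<in> carrier F" "x = \<pi> a"
      using M.a_subset by (auto simp: A_carrier)
    with that lcs_ideal_scale[of a "Suc i" c] show ?thesis
      by (simp add: lcs_ideal_def A_smult)
  qed
  have sub: "a \<in> lcs_ideal i \<inter> free_component n r d \<Longrightarrow> a \<in> carrier F \<and> \<pi> a \<in> carrier A" for a
    by (auto simp: A_carrier lcs_ideal_carrier)
  show ?thesis
  proof
    fix a b c
    assume a: "a \<in> lcs_ideal i \<inter> free_component n r d"
    show "c \<odot>\<^bsub>N\<^esub> (?M +>\<^bsub>A\<^esub> \<pi> a) = ?M +>\<^bsub>A\<^esub> \<pi> (scale_ncpoly c a)"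
      using smult_coset[OF A_module A_ring lower_central_ideal_ideal M_scale, of "\<pi> a" c] sub[OF a]
      by (simp add: N_simps A_smult)
    assume b: "b \<in> lcs_ideal i \<inter> free_component n r d"
    show "(?M +>\<^bsub>A\<^esub> \<pi> a) \<oplus>\<^bsub>N\<^esub> (?M +>\<^bsub>A\<^esub> \<pi> b) = ?M +>\<^bsub>A\<^esub> \<pi> (a + b)"
      using M.a_rcos_sum[of "\<pi> a" "\<pi> b"] sub[OF a] sub[OF b] by (simp add: N_simps A_add)
    show "(?M +>\<^bsub>A\<^esub> \<pi> a = ?M +>\<^bsub>A\<^esub> \<pi> b) = (a - b \<in> lcs_ideal (Suc i))"
      using A.quotient_eq_iff_same_a_r_cos[OF lower_central_ideal_ideal[of "Suc i"], of "\<pi> a" "\<pi> b"] sub[OF a] sub[OF b]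
      by (simp add: A_minus lcs_ideal_def carrier_free_algebra_diff)
  next
    show "\<zero>\<^bsub>N\<^esub> = ?M +>\<^bsub>A\<^esub> \<pi> 0"
      using A.a_rcos_zero[OF lower_central_ideal_ideal[of "Suc i"] M.zero_closed] by (simp add: N_simps A_zero)
    \<comment> \<open>Membership in \<open>lcs_ideal i\<close> depends only on the class, so
      intersecting before or after the projection gives the same set.\<close>
    have "lower_central_ideal A i \<inter> \<pi> ` free_component n r d = \<pi> ` (lcs_ideal i \<inter> free_component n r d)"
      using free_component_subset[of n r d] by (auto simp: lcs_ideal_def)
    then show "carrier N = (\<lambda>a. ?M +>\<^bsub>A\<^esub> \<pi> a) ` (lcs_ideal i \<inter> free_component n r d)"
      by (simp add: N_simps image_image)
  qed (auto intro: lcs_ideal_closed lcs_ideal_scale free_component_0 free_component_add free_component_scale)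
qed

end

section \<open>Hilbert series\<close>

lemma ncvar_carrier: "s \<in> {1..n} \<Longrightarrow> ncvar s \<in> carrier (free_algebra n)"
  by (simp add: in_carrier_free_algebra_iff keys_ncvar)

lemma ncvar_power_carrier: "s \<in> {1..n} \<Longrightarrow> ncvar s ^ j \<in> carrier (free_algebra n)"
  by (induction j) (simp_all add: carrier_free_algebra_closed ncvar_carrier)

text \<open>This is (x + t)^q = x^q + t^q in characteristic p, read below t^q; a different variable
  is constant for D_s.\<close>

lemma hasse_ncvar_prime_power:
  assumes p: "prime p" "CHAR('k::field) = p" and j: "0 < j" "j < p ^ e s"
  shows "hasse s j (ncvar t ^ (p ^ e t)) = (0 :: 'k ncpoly)"
proof (cases "s = t")
  case True
  \<comment> \<open>The factor 1 allows the power rule to be applied: its term l = 0 contains D^(j)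
    1 = 0, the others contain a binomial coefficient divisible by p.\<close>
  have "hasse s j (ncvar s ^ (p ^ e s) * (1 :: 'k ncpoly)) = 0"
    unfolding hasse_ncvar_power_mult
  proof (intro sum.neutral ballI)
    fix l assume l: "l \<in> {..j}"
    show "of_nat ((p ^ e s) choose l) * (ncvar s ^ (p ^ e s - l) * hasse s (j - l) 1) = (0 :: 'k ncpoly)"
    proof (cases "l = 0")
      case False
      then have "p dvd ((p ^ e s) choose l)"
        using prime_dvd_choose_prime_power[OF p(1)] l j(2) by auto
      then show ?thesis by (simp add: of_nat_ncpoly_eq_0 p(2))
    qed (use j in \<open>simp add: hasse_1\<close>)
  qed
  with True show ?thesis by simp
next
  case False
  then show ?thesis
    using hasse_ncvar_power_mult_other[of t s j "p ^ e t" "1 :: 'k ncpoly"] j by (simp add: hasse_1)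
qed

text \<open>The elements killed by all D^(j) with 0 < j < q form a subalgebra: in each Leibniz term
  for a product one of the orders i and j - i is positive and below q. It contains the generating
  powers.\<close>

lemma hasse_generated_subalgebra:
  fixes b :: "'k::field ncpoly"
  assumes p: "prime p" "CHAR('k::field) = p" and j: "0 < j" "j < p ^ e s"
    and b: "b \<in> generated_subalgebra (free_algebra n) {ncvar t ^ (p ^ e t) | t. t \<in> {1..n}}"
  shows "hasse s j b = 0"
proof -
  define B where "B = {b \<in> carrier (free_algebra n :: ('k, 'k ncpoly) module).
    \<forall>j. 0 < j \<longrightarrow> j < p ^ e s \<longrightarrow> hasse s j b = 0}"
  interpret F: ring "free_algebra n :: ('k, 'k ncpoly) module" by (rule free_algebra_ring)
  have "subring B (free_algebra n)"
  proof (rule F.subringI)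
    fix x y assume xy: "x \<in> B" "y \<in> B"
    then have "hasse s j (x * y) = 0" if "0 < j" "j < p ^ e s" for j
      unfolding hasse_mult B_def using that
      by (intro sum.neutral) (auto, metis hasse_at_0 bot_nat_0.not_eq_extremum diff_zero mult_zero_left mult_zero_right le_less_trans)
    with xy show "x \<otimes>\<^bsub>free_algebra n\<^esub> y \<in> B"
      by (simp add: B_def carrier_free_algebra_closed)
    from xy show "x \<oplus>\<^bsub>free_algebra n\<^esub> y \<in> B"
      by (simp add: B_def carrier_free_algebra_closed hasse_add)
    have "\<ominus>\<^bsub>free_algebra n\<^esub> x = - x"
      using xy by (intro F.minus_equality) (simp_all add: B_def carrier_free_algebra_closed)
    with xy show "\<ominus>\<^bsub>free_algebra n\<^esub> x \<in> B"
      by (simp add: B_def carrier_free_algebra_closed hasse_uminus)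
  qed (auto simp: B_def carrier_free_algebra_closed hasse_1)
  moreover have "\<forall>c. \<forall>b \<in> B. c \<odot>\<^bsub>free_algebra n\<^esub> b \<in> B"
    by (simp add: B_def carrier_free_algebra_closed hasse_scale scale_ncpoly_conv_mult[of _ 0])
  moreover have "{ncvar t ^ (p ^ e t) | t. t \<in> {1..n}} \<subseteq> B"
    using hasse_ncvar_prime_power[OF p] by (auto simp: B_def ncvar_power_carrier)
  ultimately have "b \<in> B" using b unfolding generated_subalgebra_def by blast
  with j show ?thesis by (simp add: B_def)
qed

text \<open>By the Leibniz rule the elements of the ideal whose derivatives of all orders below q
  stay in it form an ideal again. It contains S, since there D^(0) is the identity and the other
  orders give 0.\<close>

lemma hasse_genideal:
  fixes S :: "'k::field ncpoly set"
  assumes S: "S \<subseteq> carrier (free_algebra n)"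
    and hS: "\<And>f j. f \<in> S \<Longrightarrow> 0 < j \<Longrightarrow> j < q \<Longrightarrow> hasse s j f = 0"
    and a: "a \<in> Idl\<^bsub>free_algebra n\<^esub> S" "j < q"
  shows "hasse s j a \<in> Idl\<^bsub>free_algebra n\<^esub> S"
proof -
  interpret F: ring "free_algebra n :: ('k, 'k ncpoly) module" by (rule free_algebra_ring)
  let ?I = "Idl\<^bsub>free_algebra n\<^esub> S"
  interpret Q: free_quotient n ?I "quotient_algebra (free_algebra n) ?I"
    by (rule free_quotient.intro[OF F.genideal_ideal[OF S] refl])
  define H where "H = {a \<in> ?I. \<forall>j<q. hasse s j a \<in> ?I}"
  have sum_mem: "sum f X \<in> ?I" if "\<And>x. x \<in> X \<Longrightarrow> f x \<in> ?I" for f :: "nat \<Rightarrow> 'k ncpoly" and X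
    using that by (induction X rule: infinite_finite_induct) (auto intro: Q.I_closed)
  have minus: "- a \<in> ?I" if "a \<in> ?I" for a
    using Q.I_scale[OF that, of "- 1"] by simp
  have "ideal H (free_algebra n)"
  proof (rule idealI[OF free_algebra_ring])
    show "subgroup H (add_monoid (free_algebra n))"
    proof (rule F.add.subgroupI)
      fix x y assume xy: "x \<in> H" "y \<in> H"
      then show "x \<oplus>\<^bsub>free_algebra n\<^esub> y \<in> H" by (auto simp: H_def hasse_add intro: Q.I_closed)
      have "\<ominus>\<^bsub>free_algebra n\<^esub> x = - x"
        using xy by (intro F.minus_equality) (simp_all add: H_def Q.I_subset carrier_free_algebra_closed)
      with xy show "\<ominus>\<^bsub>free_algebra n\<^esub> x \<in> H" by (simp add: H_def hasse_uminus minus)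
    qed (use Q.I_closed(1) in \<open>auto simp: H_def Q.I_subset\<close>)
    fix x y assume "x \<in> H" "y \<in> carrier (free_algebra n :: ('k, 'k ncpoly) module)"
    then show "y \<otimes>\<^bsub>free_algebra n\<^esub> x \<in> H" "x \<otimes>\<^bsub>free_algebra n\<^esub> y \<in> H"
      unfolding H_def free_algebra_simps mem_Collect_eq hasse_mult
      by (intro conjI allI impI sum_mem Q.I_closed(3,4) hasse_carrier; simp)+
  qed
  moreover have "f \<in> H" if "f \<in> S" for f
  proof -
    have "f \<in> ?I" using F.genideal_self[OF S] that by blast
    moreover have "hasse s j f \<in> ?I" if "j < q" for j
      using hS[OF \<open>f \<in> S\<close> _ that] \<open>f \<in> ?I\<close> Q.I_closed(1) by (cases "j = 0") auto
    ultimately show ?thesis by (simp add: H_def)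
  qed
  ultimately have "?I \<subseteq> H" by (intro F.genideal_minimal) auto
  with a show ?thesis by (auto simp: H_def)
qed

section \<open>Coefficients of products with truncated geometric series\<close>

lemma mcoeff_sum: "mcoeff (\<Sum>i\<in>A. f i) d = (\<Sum>i\<in>A. mcoeff (f i) d)"
  by (induction A rule: infinite_finite_induct) (auto simp: zero_mpowser.rep_eq plus_mpowser.rep_eq)

lemma mcoeff_mX_mult:
  "mcoeff (mX s * g) d =
    (if Poly_Mapping.lookup d s = 0 then 0 else mcoeff g (d - Poly_Mapping.single s 1))"
proof -
  let ?x = "Poly_Mapping.single s 1 :: nat \<Rightarrow>\<^sub>0 nat"
  let ?f = "\<lambda>z. (if fst z = ?x then 1 else 0) * mcoeff g (snd z)"
  have eq: "mcoeff (mX s * g) d = (\<Sum>z \<in> {(a, b). a + b = d}. ?f z)"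
    by (simp add: times_mpowser.rep_eq mX.rep_eq split_def)
  show ?thesis
  proof (cases "Poly_Mapping.lookup d s = 0")
    case True
    have "a \<noteq> ?x" if "a + b = d" for a b
      using True that by (auto simp: lookup_add)
    then have "(\<Sum>z \<in> {(a, b). a + b = d}. ?f z) = 0"
      by (intro sum.neutral) auto
    with eq True show ?thesis by simp
  next
    case False
    then have split: "?x + (d - ?x) = d"
      by (intro poly_mapping_eqI) (auto simp: lookup_add lookup_minus lookup_single when_def)
    have "(\<Sum>z \<in> {(a, b). a + b = d}. ?f z) = (\<Sum>z \<in> {(?x, d - ?x)}. ?f z)"
    proof (intro sum.mono_neutral_right ballI)
      fix z assume z: "z \<in> {(a, b). a + b = d} - {(?x, d - ?x)}"
      obtain a b where ab: "z = (a, b)" by (cases z)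
      have "a \<noteq> ?x"
      proof
        assume "a = ?x"
        moreover from z ab have "a + b = d" by simp
        ultimately have "b = d - ?x" by (metis add_diff_cancel_left')
        with z ab \<open>a = ?x\<close> show False by simp
      qed
      with ab show "?f z = 0" by simp
    qed (use split in \<open>simp_all add: finite_exponent_splits\<close>)
    with eq False show ?thesis by simp
  qed
qed

lemma mcoeff_mX_power_mult:
  "mcoeff (mX s ^ j * g) d =
    (if j \<le> Poly_Mapping.lookup d s then mcoeff g (d - Poly_Mapping.single s j) else 0)"
proof (induction j arbitrary: d)
  case (Suc j)
  have "d - Poly_Mapping.single s 1 - Poly_Mapping.single s j = d - Poly_Mapping.single s (Suc j)"
    by (intro poly_mapping_eqI) (auto simp: lookup_minus lookup_single when_def)
  then show ?case
    by (auto simp: mult.assoc mcoeff_mX_mult Suc lookup_minus)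
qed simp

text \<open>The index set matches the blocks x_s^j of a basis in degree d, as counted in
  \<open>basis_mod_kernel\<close>.\<close>

lemma mcoeff_geometric_mult:
  "mcoeff ((\<Sum>j<q. mX s ^ j) * g) d =
    (\<Sum>j | j < q \<and> j \<le> Poly_Mapping.lookup d s. mcoeff g (d - Poly_Mapping.single s j))"
proof -
  have "mcoeff ((\<Sum>j<q. mX s ^ j) * g) d =
    (\<Sum>j\<in>{..<q}. if j \<le> Poly_Mapping.lookup d s then mcoeff g (d - Poly_Mapping.single s j) else 0)"
    by (simp add: sum_distrib_right mcoeff_sum mcoeff_mX_power_mult)
  also have "\<dots> = (\<Sum>j | j \<in> {..<q} \<and> j \<le> Poly_Mapping.lookup d s. mcoeff g (d - Poly_Mapping.single s j))"
    by (rule sum.inter_filter[symmetric]) simp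
  finally show ?thesis by simp
qed

lemma keys_diff_single_subset_iff:
  fixes d :: "nat \<Rightarrow>\<^sub>0 nat"
  assumes "s \<in> S"
  shows "Poly_Mapping.keys (d - Poly_Mapping.single s j) \<subseteq> S \<longleftrightarrow> Poly_Mapping.keys d \<subseteq> S"
proof -
  have keys: "Poly_Mapping.keys c \<subseteq> S \<longleftrightarrow> (\<forall>t. t \<notin> S \<longrightarrow> Poly_Mapping.lookup c t = 0)"
    for c :: "nat \<Rightarrow>\<^sub>0 nat"
  proof (intro iffI allI impI subsetI)
    fix t assume "Poly_Mapping.keys c \<subseteq> S" "t \<notin> S"
    then have "t \<notin> Poly_Mapping.keys c" by (rule contra_subsetD)
    then show "Poly_Mapping.lookup c t = 0" by (simp only: in_keys_iff not_not)
  next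
    fix t assume *: "\<forall>t. t \<notin> S \<longrightarrow> Poly_Mapping.lookup c t = 0" "t \<in> Poly_Mapping.keys c"
    then have "Poly_Mapping.lookup c t \<noteq> 0" by (simp only: in_keys_iff not_False_eq_True)
    with * show "t \<in> S" by (cases "t \<in> S") simp_all
  qed
  have "Poly_Mapping.lookup (d - Poly_Mapping.single s j) t = Poly_Mapping.lookup d t" if "t \<notin> S" for t
    using assms that by (cases "t = s") (simp_all add: lookup_minus lookup_single)
  then show ?thesis by (simp add: keys)
qed

lemma mpowser_in_vars_geometric_mult:
  assumes "s \<in> S" "mpowser_in_vars S g"
  shows "mpowser_in_vars S ((\<Sum>j<q. mX s ^ j) * g)"
  using assms by (auto simp: mpowser_in_vars_def mcoeff_geometric_mult keys_diff_single_subset_iff)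

section \<open>Splitting off the variables one at a time\<close>

locale hasse_quotient = free_quotient n I A
  for n :: nat and I :: "'k::field ncpoly set" and A :: "('k, 'k ncpoly set) module" +
  fixes q :: "nat \<Rightarrow> nat" and r i :: nat
  assumes r_le_n: "r \<le> n"
    and q_pos: "q s > 0"
    and q_carry: "b < q s \<Longrightarrow> c < q s \<Longrightarrow> q s \<le> b + c \<Longrightarrow>
      (of_int (int ((b + c) choose b)) :: 'k ncpoly) = 0"
    and I_hasse: "a \<in> I \<Longrightarrow> j < q s \<Longrightarrow> hasse s j a \<in> I"
begin

abbreviation W :: "'k ncpoly set" where "W \<equiv> lcs_ideal (Suc i)"

text \<open>Representatives of the joint kernel, in degree d of N_i(A), of the operators for the
  variables in S. It runs from the whole component at S = {} to the space counted by the quotient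
  series at S = {1..r}.\<close>

definition hasse_kernel :: "nat set \<Rightarrow> (nat \<Rightarrow>\<^sub>0 nat) \<Rightarrow> 'k ncpoly set"
  where "hasse_kernel S d = {u \<in> lcs_ideal i \<inter> free_component n r d.
    \<forall>s\<in>S. \<forall>j. 0 < j \<longrightarrow> j < q s \<longrightarrow> hasse s j u \<in> W}"

lemma hasse_stable_lcs_ideal:
  assumes "s \<in> {1..r}"
  shows "hasse_stable s (q s) (lcs_ideal m)"
proof
  have "s \<in> {1..n}" using assms r_le_n by auto
  then show "ncvar s * a \<in> lcs_ideal m" if "a \<in> lcs_ideal m" for a
    by (intro lcs_ideal_closed(3) ncvar_carrier that)
qed (auto intro: lcs_ideal_closed lcs_ideal_uminus hasse_lcs_ideal[OF I_hasse])

text \<open>Left multiplication by x_s commutes with the D_t for t other than s, so it keeps the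
  conditions for S; a condition at s itself would be destroyed.\<close>

lemma ncvar_power_mult_kernel:
  assumes s: "s \<in> {1..r}" "s \<notin> S" and j: "j \<le> Poly_Mapping.lookup d s"
    and b: "b \<in> hasse_kernel S (d - Poly_Mapping.single s j)"
  shows "ncvar s ^ j * b \<in> hasse_kernel S d"
proof -
  have sn: "s \<in> {1..n}" using s r_le_n by auto
  have "d - Poly_Mapping.single s j + Poly_Mapping.single s j = d"
    using j by (intro poly_mapping_eqI) (auto simp: lookup_add lookup_minus lookup_single when_def)
  then have "ncvar s ^ j * b \<in> free_component n r d"
    using ncvar_power_mult_free_component[of b n r "d - Poly_Mapping.single s j" s j] b sn
    by (simp add: hasse_kernel_def)
  moreover have "hasse t l (ncvar s ^ j * b) \<in> W" if "t \<in> S" "0 < l" "l < q t" for t l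
  proof -
    have "s \<noteq> t" using s that by auto
    have "hasse t l b \<in> W" using b that by (simp add: hasse_kernel_def)
    then show ?thesis unfolding hasse_ncvar_power_mult_other[OF \<open>s \<noteq> t\<close>]
      by (intro lcs_ideal_closed(3) ncvar_power_carrier sn)
  qed
  moreover have "ncvar s ^ j * b \<in> lcs_ideal i"
    using b sn by (intro lcs_ideal_closed(3) ncvar_power_carrier) (auto simp: hasse_kernel_def)
  ultimately show ?thesis by (simp add: hasse_kernel_def)
qed

text \<open>The projection supplies the new condition at s, even with exact vanishing in the free
  algebra. The old conditions persist because P and D_s^(j) commute with D_t for t other than s and
  preserve W.\<close>

lemma hasse_proj_hasse_kernel:
  assumes s: "s \<in> {1..r}" "s \<notin> S" and S: "S \<subseteq> {1..r}" and j: "j < q s"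
    and u: "u \<in> hasse_kernel S d"
  shows "hasse_proj s (q s) (hasse s j u) \<in> hasse_kernel (insert s S) (d - Poly_Mapping.single s j)"
proof -
  interpret L: hasse_stable s "q s" "lcs_ideal i" by (rule hasse_stable_lcs_ideal[OF s(1)])
  interpret W: hasse_stable s "q s" W by (rule hasse_stable_lcs_ideal[OF s(1)])
  have "hasse_proj s (q s) (hasse s j u) \<in> lcs_ideal i"
    using u j by (auto simp: hasse_kernel_def intro: L.hasse_proj_mem L.hasse_mem)
  moreover have "hasse_proj s (q s) (hasse s j u) \<in> free_component n r (d - Poly_Mapping.single s j)"
    using u s r_le_n by (auto simp: hasse_kernel_def intro!: hasse_proj_free_component hasse_free_component)
  moreover have "hasse s l (hasse_proj s (q s) (hasse s j u)) = 0" if "0 < l" "l < q s" for l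
    by (rule hasse_hasse_proj[OF q_pos q_carry that])
  moreover have "hasse t l (hasse_proj s (q s) (hasse s j u)) \<in> W" if "t \<in> S" "0 < l" "l < q t" for t l
  proof -
    have "s \<noteq> t" using s that by auto
    then have "hasse t l (hasse_proj s (q s) (hasse s j u)) = hasse_proj s (q s) (hasse s j (hasse t l u))"
      by (simp add: hasse_proj_hasse_other hasse_commute[of t])
    also have "\<dots> \<in> W"
      using u that j by (auto simp: hasse_kernel_def intro: W.hasse_proj_mem W.hasse_mem)
    finally show ?thesis .
  qed
  ultimately show ?thesis by (auto simp: hasse_kernel_def)
qed

text \<open>One variable is split off: modulo W the kernel for S in degree d is the direct sum of
  the x_s^j times the kernel for \<open>insert s S\<close> in degree d lowered by j at s. Spanning
  comes from \<open>hasse_proj_expansion\<close>, independence from the coefficient functionals P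
  D^(l).\<close>

lemma basis_mod_kernel:
  assumes s: "s \<in> {1..r}" "s \<notin> S" and S: "S \<subseteq> {1..r}"
    and B: "\<And>j. j < q s \<Longrightarrow> j \<le> Poly_Mapping.lookup d s \<Longrightarrow>
      basis_mod scale_ncpoly (hasse_kernel (insert s S) (d - Poly_Mapping.single s j)) W (B j)"
  shows "\<exists>C. basis_mod scale_ncpoly (hasse_kernel S d) W C \<and>
    card C = (\<Sum>j | j < q s \<and> j \<le> Poly_Mapping.lookup d s. card (B j))"
proof -
  interpret W: hasse_stable s "q s" W by (rule hasse_stable_lcs_ideal[OF s(1)])
  define J where "J = {j. j < q s \<and> j \<le> Poly_Mapping.lookup d s}"
  let ?K = "Sigma J B"
  let ?v = "\<lambda>(j, b). ncvar s ^ j * b"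
  let ?P = "hasse_proj s (q s)"
  have finJ: "finite J" by (simp add: J_def)
  have B: "finite (B j)" "B j \<subseteq> hasse_kernel (insert s S) (d - Poly_Mapping.single s j)"
    "independent_mod scale_ncpoly W (B j)"
    "u \<in> hasse_kernel (insert s S) (d - Poly_Mapping.single s j) \<Longrightarrow>
      \<exists>c. u - (\<Sum>b\<in>B j. scale_ncpoly (c b) b) \<in> W" if "j \<in> J" for j u
    using B[of j] that by (auto simp: J_def basis_mod_def independent_mod_def)
  have scale_mult: "x * scale_ncpoly c y = scale_ncpoly c (x * y)" for x y :: "'k ncpoly" and c
    unfolding scale_ncpoly_conv_mult by (rule single_0_left_commute)
  have fin: "finite ?K" using finJ B(1) by auto
  have vU: "?v k \<in> hasse_kernel S d" if "k \<in> ?K" for k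
  proof -
    obtain j b where k: "k = (j, b)" "j \<in> J" "b \<in> B j" using \<open>k \<in> ?K\<close> by (cases k) auto
    then have "b \<in> hasse_kernel S (d - Poly_Mapping.single s j)"
      using B(2)[of j] by (auto simp: hasse_kernel_def)
    then show ?thesis using ncvar_power_mult_kernel[OF s] k by (auto simp: J_def)
  qed
  have span: "\<exists>c. u - (\<Sum>k\<in>?K. scale_ncpoly (c k) (?v k)) \<in> W" if u: "u \<in> hasse_kernel S d" for u
  proof -
    have "\<exists>c. ?P (hasse s j u) - (\<Sum>b\<in>B j. scale_ncpoly (c b) b) \<in> W" if "j \<in> J" for j
      using that by (intro B(4) hasse_proj_hasse_kernel s S u) (auto simp: J_def)
    then obtain c where c: "\<And>j. j \<in> J \<Longrightarrow> ?P (hasse s j u) - (\<Sum>b\<in>B j. scale_ncpoly (c j b) b) \<in> W"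
      by metis
    have "u = (\<Sum>j<q s. ncvar s ^ j * ?P (hasse s j u))"
      by (rule hasse_proj_expansion[OF q_pos q_carry, symmetric])
    \<comment> \<open>Orders above the degree of u in x_s contribute 0, which matches the absence of
      blocks there.\<close>
    also have "\<dots> = (\<Sum>j\<in>J. ncvar s ^ j * ?P (hasse s j u))"
    proof (rule sum.mono_neutral_right)
      show "\<forall>j\<in>{..<q s} - J. ncvar s ^ j * ?P (hasse s j u) = 0"
      proof
        fix j assume "j \<in> {..<q s} - J"
        then have "Poly_Mapping.lookup d s < j" by (auto simp: J_def)
        with u have "hasse s j u = 0"
          by (intro hasse_eq_0[OF _ s(1)]) (auto simp: hasse_kernel_def)
        then show "ncvar s ^ j * ?P (hasse s j u) = 0" by simp
      qed
    qed (auto simp: J_def)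
    finally have u_eq: "u = (\<Sum>j\<in>J. ncvar s ^ j * ?P (hasse s j u))" .
    have "(\<Sum>k\<in>?K. scale_ncpoly (case k of (j, b) \<Rightarrow> c j b) (?v k)) =
      (\<Sum>j\<in>J. \<Sum>b\<in>B j. scale_ncpoly (c j b) (ncvar s ^ j * b))"
      using finJ B(1) by (subst sum.Sigma) (auto simp: split_def)
    also have "\<dots> = (\<Sum>j\<in>J. ncvar s ^ j * (\<Sum>b\<in>B j. scale_ncpoly (c j b) b))"
      by (simp add: sum_distrib_left scale_mult)
    finally have "u - (\<Sum>k\<in>?K. scale_ncpoly (case k of (j, b) \<Rightarrow> c j b) (?v k)) =
      (\<Sum>j\<in>J. ncvar s ^ j * ?P (hasse s j u)) -
      (\<Sum>j\<in>J. ncvar s ^ j * (\<Sum>b\<in>B j. scale_ncpoly (c j b) b))"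
      by (rule arg_cong2[OF u_eq, of _ _ "(-)"])
    also have "\<dots> =
      (\<Sum>j\<in>J. ncvar s ^ j * (?P (hasse s j u) - (\<Sum>b\<in>B j. scale_ncpoly (c j b) b)))"
      by (simp add: right_diff_distrib sum_subtractf)
    also have "\<dots> \<in> W" by (intro W.sum_mem W.ncvar_power_mult_mem c)
    finally show ?thesis by (rule exI[of _ "\<lambda>(j, b). c j b"])
  qed
  have indep: "c k = 0" if z: "(\<Sum>k\<in>?K. scale_ncpoly (c k) (?v k)) \<in> W" and k: "k \<in> ?K" for c k
  proof -
    obtain l b where lb: "k = (l, b)" "l \<in> J" "b \<in> B l" using k by (cases k) auto
    \<comment> \<open>The value, modulo W, of P D^(l) on the basis element with index k: its b if it
      lies in block l, and 0 otherwise. Applied to a relation, P D^(l) leaves a relation within B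
      l.\<close>
    let ?g = "\<lambda>k. if l = fst k then snd k else 0"
    have "(\<Sum>k\<in>?K. scale_ncpoly (c k) (?P (hasse s l (?v k)))) \<in> W"
      using W.hasse_proj_mem[OF W.hasse_mem[OF z, of l]] lb
      by (simp add: hasse_sum hasse_scale hasse_proj_sum hasse_proj_scale J_def)
    moreover have "(\<Sum>k\<in>?K. scale_ncpoly (c k) (?P (hasse s l (?v k)) - ?g k)) \<in> W"
    proof (intro W.sum_mem lcs_ideal_scale)
      fix k assume "k \<in> ?K"
      then obtain j b where jb: "k = (j, b)" "j \<in> J" "b \<in> B j" by (cases k) auto
      then have "hasse s m b \<in> W" if "0 < m" "m < q s" for m
        using B(2)[of j] that by (auto simp: hasse_kernel_def)
      from W.hasse_proj_hasse_ncvar_power_mult_cong[OF this, of l j]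
      show "?P (hasse s l (?v k)) - ?g k \<in> W"
        using jb lb by (auto simp: J_def)
    qed
    ultimately have "(\<Sum>k\<in>?K. scale_ncpoly (c k) (?P (hasse s l (?v k)))) -
      (\<Sum>k\<in>?K. scale_ncpoly (c k) (?P (hasse s l (?v k)) - ?g k)) \<in> W"
      by (rule W.diff_mem)
    also have "(\<Sum>k\<in>?K. scale_ncpoly (c k) (?P (hasse s l (?v k)))) -
      (\<Sum>k\<in>?K. scale_ncpoly (c k) (?P (hasse s l (?v k)) - ?g k)) = (\<Sum>k\<in>?K. scale_ncpoly (c k) (?g k))"
      by (simp add: ncpoly.scale_right_diff_distrib sum_subtractf)
    also have "\<dots> = (\<Sum>j\<in>J. \<Sum>b\<in>B j. scale_ncpoly (c (j, b)) (if l = j then b else 0))"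
      using finJ B(1) by (subst sum.Sigma) (auto simp: split_def)
    also have "\<dots> = (\<Sum>j\<in>J. if l = j then \<Sum>b\<in>B j. scale_ncpoly (c (j, b)) b else 0)"
      by (intro sum.cong refl) auto
    also have "\<dots> = (\<Sum>b\<in>B l. scale_ncpoly (c (l, b)) b)"
      using finJ lb(2) by simp
    finally show ?thesis
      using independent_modD[OF B(3)[OF lb(2)], of "\<lambda>b. c (l, b)" b] lb by simp
  qed
  have "basis_mod scale_ncpoly (hasse_kernel S d) W (?v ` ?K) \<and> card (?v ` ?K) = card ?K"
  proof (intro conjI ncpoly.basis_mod_family[where U = "hasse_kernel S d" and W = W])
    fix c k assume "(\<Sum>k\<in>?K. scale_ncpoly (c k) (?v k)) \<in> W" "k \<in> ?K"
    then show "c k = 0" "c k = 0" by (rule indep)+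
  qed (fact fin vU span lcs_ideal_closed(1))+
  moreover have "card ?K = (\<Sum>j\<in>J. card (B j))"
    using finJ B(1) by (intro card_SigmaI) auto
  ultimately have "basis_mod scale_ncpoly (hasse_kernel S d) W (?v ` ?K) \<and>
      card (?v ` ?K) = (\<Sum>j\<in>J. card (B j))"
    by (simp only: simp_thms)
  then show ?thesis unfolding J_def by (rule exI[where x = "_ ` _"])
qed

text \<open>The coefficients of g are the dimensions modulo W of the joint kernels, hence
  nonnegative. Each variable split off multiplies the series by its geometric factor.\<close>

lemma hilbert_series_divisible:
  assumes N: "\<And>d. N d = lower_central_component A i (\<pi> ` free_component n r d)"
    and fd: "\<And>d. Poly_Mapping.keys d \<subseteq> {1..r} \<Longrightarrow> vectorspace.fin_dim class_ring (N d)"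
  shows "\<exists>g :: int mpowser. mpowser_in_vars {1..r} g \<and> (\<forall>d. mcoeff g d \<ge> 0) \<and>
           hilbert_series r N = (\<Prod>s = 1..r. \<Sum>j<q s. mX s ^ j) * g"
proof -
  note quot = lower_central_component_quotient[OF N]
  have "\<exists>B. basis_mod scale_ncpoly (hasse_kernel {1..r} d) W B" if "Poly_Mapping.keys d \<subseteq> {1..r}" for d
    by (rule subspace_quotient.basis_mod_exists[OF quot fd[OF that]]) (auto simp: hasse_kernel_def)
  then obtain B where B: "\<And>d. Poly_Mapping.keys d \<subseteq> {1..r} \<Longrightarrow>
      basis_mod scale_ncpoly (hasse_kernel {1..r} d) W (B d)"
    by metis
  define g where "g = Abs_mpowser (\<lambda>d. if Poly_Mapping.keys d \<subseteq> {1..r} then int (card (B d)) else 0)"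
  have mg: "mcoeff g d = (if Poly_Mapping.keys d \<subseteq> {1..r} then int (card (B d)) else 0)" for d
    by (simp add: g_def Abs_mpowser_inverse)
  let ?h = "\<lambda>T. (\<Prod>s\<in>T. \<Sum>j<q s. mX s ^ j) * g"
  \<comment> \<open>T is the set of variables already split off, so the conditions that remain are
    those for {1..r} - T. The support statement is carried along because the comparison of
    coefficients must also cover exponents outside {1..r}.\<close>
  have main: "mpowser_in_vars {1..r} (?h T) \<and> (\<forall>d. Poly_Mapping.keys d \<subseteq> {1..r} \<longrightarrow>
    (\<exists>C. basis_mod scale_ncpoly (hasse_kernel ({1..r} - T) d) W C \<and> int (card C) = mcoeff (?h T) d))"
    if "finite T" "T \<subseteq> {1..r}" for T
    using that
  proof (induction T)
    case empty
    show ?case using B by (auto simp: mpowser_in_vars_def mg)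
  next
    case (insert s T)
    let ?S = "{1..r} - insert s T"
    have s: "s \<in> {1..r}" "s \<notin> ?S" "?S \<subseteq> {1..r}" and S: "insert s ?S = {1..r} - T"
      using insert by auto
    have h: "?h (insert s T) = (\<Sum>j<q s. mX s ^ j) * ?h T"
      using insert by (simp add: mult.assoc)
    have IH: "mpowser_in_vars {1..r} (?h T)"
      "\<And>d. Poly_Mapping.keys d \<subseteq> {1..r} \<Longrightarrow>
        \<exists>C. basis_mod scale_ncpoly (hasse_kernel (insert s ?S) d) W C \<and> int (card C) = mcoeff (?h T) d"
      using insert unfolding S by auto
    \<comment> \<open>Bases are chosen for all degrees at once: the step to degree d combines those
      of the degrees lowered at s.\<close>
    have "\<forall>d. \<exists>C. Poly_Mapping.keys d \<subseteq> {1..r} \<longrightarrow>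
        basis_mod scale_ncpoly (hasse_kernel (insert s ?S) d) W C \<and> int (card C) = mcoeff (?h T) d"
      using IH(2) by blast
    from choice[OF this] obtain C where
      C: "\<And>d. Poly_Mapping.keys d \<subseteq> {1..r} \<Longrightarrow> basis_mod scale_ncpoly (hasse_kernel (insert s ?S) d) W (C d)"
      and card_C: "\<And>d. Poly_Mapping.keys d \<subseteq> {1..r} \<Longrightarrow> int (card (C d)) = mcoeff (?h T) d"
      by blast
    have "\<exists>D. basis_mod scale_ncpoly (hasse_kernel ?S d) W D \<and> int (card D) = mcoeff (?h (insert s T)) d"
      if d: "Poly_Mapping.keys d \<subseteq> {1..r}" for d
    proof -
      have keys: "Poly_Mapping.keys (d - Poly_Mapping.single s j) \<subseteq> {1..r}" for j
        using d s(1) by (simp only: keys_diff_single_subset_iff)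
      obtain D where "basis_mod scale_ncpoly (hasse_kernel ?S d) W D"
        "card D = (\<Sum>j | j < q s \<and> j \<le> Poly_Mapping.lookup d s. card (C (d - Poly_Mapping.single s j)))"
        using basis_mod_kernel[OF s, of d "\<lambda>j. C (d - Poly_Mapping.single s j)"] C[OF keys] by blast
      then show ?thesis unfolding h mcoeff_geometric_mult
        by (intro exI[of _ D]) (simp add: card_C[OF keys])
    qed
    then show ?case using mpowser_in_vars_geometric_mult[OF s(1) IH(1), of "q s"] by (simp only: h) blast
  qed
  have "mcoeff (hilbert_series r N) d = mcoeff (?h {1..r}) d" for d
  proof (cases "Poly_Mapping.keys d \<subseteq> {1..r}")
    case True
    then obtain C where C: "basis_mod scale_ncpoly (hasse_kernel {} d) W C" "int (card C) = mcoeff (?h {1..r}) d"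
      using main[of "{1..r}"] by auto
    have "hasse_kernel {} d = lcs_ideal i \<inter> free_component n r d"
      by (auto simp: hasse_kernel_def)
    with C True subspace_quotient.dim_eq_card[OF quot] show ?thesis
      by (simp add: hilbert_series.rep_eq)
  next
    case False
    then show ?thesis
      using main[of "{1..r}"] by (simp add: hilbert_series.rep_eq mpowser_in_vars_def)
  qed
  then have "hilbert_series r N = ?h {1..r}" by (rule mpowser_eqI)
  then show ?thesis
    by (intro exI[of _ g]) (auto simp: mg mpowser_in_vars_def)
qed

end

theorem corollary2p13:
  fixes p n m r i :: nat
    and e :: "nat \<Rightarrow> nat"
    and f :: "nat \<Rightarrow> 'k::alg_closed_field ncpoly"
    and I :: "'k ncpoly set"
    and A :: "('k, 'k ncpoly set) module"
    and N :: "(nat \<Rightarrow>\<^sub>0 nat) \<Rightarrow> ('k, 'k ncpoly set set) module"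
  assumes "prime p" and "p > 2" and "CHAR('k) = p"
    and "n \<ge> 1"
    and "\<And>l. l \<in> {1..m} \<Longrightarrow>
           f l \<in> generated_subalgebra (free_algebra n) {ncvar s ^ (p ^ e s) | s. s \<in> {1..n}}"
    and "I = Idl\<^bsub>free_algebra n\<^esub> (f ` {1..m})"
    and "A = quotient_algebra (free_algebra n) I"
    and "1 \<le> r" and "r \<le> n"
    and "\<And>l s. l \<in> {1..m} \<Longrightarrow> s \<in> {1..r} \<Longrightarrow> homogeneous_in s (f l)"
    and "i \<ge> 1"
    and "\<And>d. N d =
           lower_central_component A i ((\<lambda>a. I +>\<^bsub>free_algebra n\<^esub> a) ` free_component n r d)"
    and "\<And>d. Poly_Mapping.keys d \<subseteq> {1..r} \<Longrightarrow> vectorspace.fin_dim class_ring (N d)"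
  shows "\<exists>g :: int mpowser.
           mpowser_in_vars {1..r} g \<and> (\<forall>d. mcoeff g d \<ge> 0) \<and>
           hilbert_series r N = (\<Prod>s = 1..r. \<Sum>j<p ^ e s. mX s ^ j) * g"
proof -
  interpret F: ring "free_algebra n :: ('k, 'k ncpoly) module" by (rule free_algebra_ring)
  have f_carrier: "f ` {1..m} \<subseteq> carrier (free_algebra n)"
  proof -
    \<comment> \<open>The free algebra on n letters is itself one of the subalgebras in the defining
      intersection.\<close>
    have "subring (carrier (free_algebra n)) (free_algebra n :: ('k, 'k ncpoly) module)"
      by (rule F.carrier_is_subring)
    then have "generated_subalgebra (free_algebra n) {ncvar s ^ (p ^ e s) | s. s \<in> {1..n}}
        \<subseteq> carrier (free_algebra n :: ('k, 'k ncpoly) module)"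
      unfolding generated_subalgebra_def
      by (intro Inter_lower) (auto intro: carrier_free_algebra_closed ncvar_power_carrier)
    then show ?thesis using assms(5) by blast
  qed
  \<comment> \<open>Characteristic p is used at two places only: the vanishing binomial coefficients
    for \<open>q_carry\<close>, and the vanishing derivatives of the generators f_l, from which
    stability of I follows.\<close>
  interpret hasse_quotient n I A "\<lambda>s. p ^ e s" r i
  proof (intro hasse_quotient.intro hasse_quotient_axioms.intro free_quotient.intro)
    show "ideal I (free_algebra n)" unfolding assms(6) by (rule F.genideal_ideal[OF f_carrier])
    show "0 < p ^ e s" for s using assms(1) by (simp add: prime_gt_0_nat)
    show "(of_int (int ((a + b) choose a)) :: 'k ncpoly) = 0"
      if "a < p ^ e s" "b < p ^ e s" "p ^ e s \<le> a + b" for a b s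
      using of_nat_ncpoly_eq_0[where 'k = 'k] prime_dvd_choose_carry[OF assms(1) that] assms(3) by simp
    show "hasse s j a \<in> I" if "a \<in> I" "j < p ^ e s" for a s j
      unfolding assms(6)
    proof (rule hasse_genideal[OF f_carrier])
      fix b j assume "b \<in> f ` {1..m}" "0 < j" "j < p ^ e s"
      then show "hasse s j b = 0"
        using hasse_generated_subalgebra[OF assms(1,3)] assms(5) by blast
    qed (use that assms(6) in auto)
  qed (use assms in auto)
  show ?thesis by (rule hilbert_series_divisible[OF assms(12,13)])
qed

end
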